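(* Let $0<\delta\le a\le b\le r$, let $B\subset\mathbb R^3$ be a labelled $a\times b\times r$ rectangular box, and let $\mathcal T_B$ be a labelled family of $N\ge1$ $\delta\times\delta\times r$ tubes contained in $B$, with measurable shadings $Y(T)\subset T$. Let $0<\sigma\le1$ and suppose that for every convex $K\subset B$, $$\frac{\#\{T\in\mathcal T_B:T\subset K\}}{N}\le C_0\left(\frac{|K|}{|B|}\right)^{1+\sigma}.$$ Put $s=a/b$, $q=2-\sigma$, $\lambda_B=\sum_{T\in\mathcal T_B}|Y(T)|\big/\sum_{T\in\mathcal T_B}|T|$ and $U=\bigcup_{T\in\mathcal T_B}Y(T)$. Then for every $\varepsilon>0$, $$|B\cap N_a(U)|\gtrsim_{\varepsilon,\sigma}C_0^{-q}\,s^{\varepsilon}\,\lambda_B^{q}\,|B| .$$ Moreover, for every $\eta>0$, $$|B\cap N_a(U)|\gtrsim_{\eta,\sigma}C_0^{-q}\,[\log(2/s)]^{-q}\,s^{q\eta}\,\lambda_B^{q}\,|B| .$$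
   Context: Labels: the family is indexed, different labels may have the same tube, and counts and sums are over labels. $|\cdot|$ is Lebesgue measure; $N_a(E)=\{x:\operatorname{dist}(x,E)<a\}$. A $\delta\times\delta\times r$ tube is the closed neighbourhood, of radius comparable to $\delta$ with fixed structural constants, of a segment of length in $[c_{\rm len}r,C_{\rm len}r]$ (endpoint caps included); the box may be arbitrarily oriented. Implicit constants depend only on the displayed parameters and the fixed structural constants, not on $\delta,a,b,r,N$, the labels or the shadings. *)

theory Defs
  imports "HOL-Analysis.Analysis"
begin

text \<open>Rectangular boxes with side lengths \<open>a\<close>, \<open>b\<close>, \<open>r\<close>, in arbitrary position: the image of
  \<open>[0,a] \<times> [0,b] \<times> [0,r]\<close> under an isometry.\<close>

definition rect_box :: "real \<Rightarrow> real \<Rightarrow> real \<Rightarrow> (real^3) set \<Rightarrow> bool" where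
  "rect_box a b r B \<longleftrightarrow>
     (\<exists>(p :: real^3) (f :: real^3 \<Rightarrow> real^3). orthogonal_transformation f \<and>
            B = (\<lambda>x. p + f x) ` cbox 0 (vector [a, b, r]))"

text \<open>The numbers \<open>crad\<close>, \<open>Crad\<close>, \<open>clen\<close>, \<open>Clen\<close> are the structural constants. The radius and the
  length may differ from tube to tube within the permitted ranges.\<close>

definition is_tube ::
    "real \<Rightarrow> real \<Rightarrow> real \<Rightarrow> real \<Rightarrow> real \<Rightarrow> real \<Rightarrow> (real^3) set \<Rightarrow> bool" where
  "is_tube crad Crad clen Clen \<delta> r T \<longleftrightarrow>
     (\<exists>p q \<rho>. clen * r \<le> dist p q \<and> dist p q \<le> Clen * r \<and>
              crad * \<delta> \<le> \<rho> \<and> \<rho> \<le> Crad * \<delta> \<and>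
              T = {x. infdist x (closed_segment p q) \<le> \<rho>})"

text \<open>Since \<open>infdist x {} = 0\<close>, the empty set has to be excluded by hand: its neighbourhood is empty.\<close>

definition open_nbhd :: "real \<Rightarrow> (real^3) set \<Rightarrow> (real^3) set" where
  "open_nbhd a E = {x. E \<noteq> {} \<and> infdist x E < a}"

text \<open>Labels are natural numbers, so that a constant can be uniform over all finite labelled families.
  The maps \<open>T\<close> and \<open>Y\<close> need not be injective on the label set \<open>I\<close>.\<close>

definition shaded_tubes_in_box ::
    "real \<Rightarrow> real \<Rightarrow> real \<Rightarrow> real \<Rightarrow> real \<Rightarrow> real \<Rightarrow> (real^3) set \<Rightarrow>
     nat set \<Rightarrow> (nat \<Rightarrow> (real^3) set) \<Rightarrow> (nat \<Rightarrow> (real^3) set) \<Rightarrow> bool" where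
  "shaded_tubes_in_box crad Crad clen Clen \<delta> r B I T Y \<longleftrightarrow>
     finite I \<and> card I \<ge> 1 \<and>
     (\<forall>i\<in>I. is_tube crad Crad clen Clen \<delta> r (T i) \<and> T i \<subseteq> B \<and>
            Y i \<in> sets lebesgue \<and> Y i \<subseteq> T i)"

definition convex_concentration_bound ::
    "real \<Rightarrow> real \<Rightarrow> (real^3) set \<Rightarrow> nat set \<Rightarrow> (nat \<Rightarrow> (real^3) set) \<Rightarrow> bool" where
  "convex_concentration_bound C\<^sub>0 \<sigma> B I T \<longleftrightarrow>
     (\<forall>K. convex K \<and> K \<subseteq> B \<longrightarrow>
        real (card {i\<in>I. T i \<subseteq> K}) / real (card I)
          \<le> C\<^sub>0 * (measure lebesgue K / measure lebesgue B) powr (1 + \<sigma>))"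

definition shading_density ::
    "nat set \<Rightarrow> (nat \<Rightarrow> (real^3) set) \<Rightarrow> (nat \<Rightarrow> (real^3) set) \<Rightarrow> real" where
  "shading_density I T Y =
     (\<Sum>i\<in>I. measure lebesgue (Y i)) / (\<Sum>i\<in>I. measure lebesgue (T i))"

end

theory Submission
  imports Defs
begin

text \<open>
  Let \<open>W\<close> be the part of the box within \<open>a\<close> of the shadings and \<open>\<lambda>\<close> the shading density. The proof gives
  \<open>|W| \<ge> c C\<^sub>0\<^bsup>-1\<^esup> \<lambda>\<^bsup>q\<^esup> |B|\<close> with \<open>c\<close> depending on \<open>\<sigma>\<close> and the structural constants, and both estimates follow since
  \<open>C\<^sub>0 \<ge> 1\<close>, \<open>a / b \<le> 1\<close> and \<open>ln (2 / (a / b)) \<ge> ln 2\<close>.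

  \<^bold>\<open>Reduction to lines.\<close> Thickening the shading of a \<open>\<delta>\<close>-tube by \<open>a\<close> multiplies its measure by at least about
  \<open>(a / \<delta>)\<^sup>2\<close>, the ratio of the cross sections (\<open>thickening_measure\<close>). Since the box has thickness \<open>a\<close>, the thickened tubes
  reach across its short side: rescaled to the unit cube, they become strips of width \<open>s \<approx> a / b\<close> about lines of a plane. Slabs are convex, so at most about \<open>C\<^sub>0 N w\<^bsup>1+\<sigma>\<^esup>\<close> of these lines lie in any slab of width \<open>w \<ge> s\<close>
  (\<open>concentration_imp_slab_count\<close>). It remains to show that a set \<open>W\<close> in the unit cube satisfies
  \<open>\<Sum>\<^sub>i |W \<inter> strip\<^sub>i| \<le> C N s V\<^bsup>1/q\<^esup>\<close> with \<open>V = C\<^sub>0 |W|\<close> (\<open>incidence_mass\<close>).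

  \<^bold>\<open>Incidences.\<close> The bound interpolates between a pointwise and a mean square estimate for the sum \<open>f\<close> of
  the strips. Fix a scale \<open>\<rho> = M s\<close> and split \<open>f = g + h\<close>, where \<open>g\<close> replaces every strip by
  the average of \<open>M\<close> adjacent translates, a fainter strip of width \<open>\<rho>\<close>.

  \<^item> The lines within \<open>\<rho>\<close> of a point lie in \<open>O(1/\<rho>)\<close> slabs of width \<open>O(\<rho>)\<close>, so \<open>g\<close> is at most about
    \<open>C\<^sub>0 N s \<rho>\<^bsup>\<sigma>-1\<^esup>\<close> everywhere (\<open>wide_sum_le\<close>).
  \<^item> Two strips crossing at angle \<open>\<theta>\<close> meet in measure about \<open>s\<^sup>2/\<theta>\<close>. For \<open>\<theta> > \<rho>\<close> the oscillations nearly cancel: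
    shifting one strip across itself by at most \<open>2\<rho>\<close> amounts to a shift along the other by \<open>2\<rho>/\<theta>\<close>, which a Lipschitz weight
    hardly feels, so a further factor \<open>\<rho>/\<theta>\<close> is gained (\<open>energy_far\<close>). About \<open>C\<^sub>0 N w\<^bsup>1+\<sigma>\<^esup>\<close> lines are \<open>w\<close>-close to a given
    one; summing over dyadic \<open>w\<close>, the scale \<open>w = \<rho>\<close> dominates on both sides when \<open>0 < \<sigma> < 1\<close>, and the mean square of \<open>h\<close> is at most about
    \<open>C\<^sub>0 N\<^sup>2 s\<^sup>2 \<rho>\<^bsup>\<sigma>\<^esup>\<close> (\<open>energy_sum_le\<close>).

  Together these bound the mass \<open>\<Sum>\<^sub>i |W \<inter> strip\<^sub>i|\<close> by about \<open>N s (V \<rho>\<^bsup>\<sigma>-1\<^esup> + \<rho>)\<close> (\<open>incidence_mass_one_scale\<close>). The choice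
  \<open>\<rho> = V\<^bsup>1/q\<^esup>\<close> with \<open>q = 2 - \<sigma>\<close> balances the two terms. If it is smaller than \<open>s\<close>, or if \<open>\<sigma> = 1\<close>, the
  pointwise bound at \<open>\<rho> = s\<close> alone does the job.
\<close>

section \<open>Linear heights and the measure of crossing slabs\<close>

text \<open>The coordinate of \<open>x\<close> along the unit normal \<open>(0, cos \<phi>, sin \<phi>)\<close>. A box of
  thickness \<open>a\<close> is flat at scale \<open>a\<close>, so the problem lives in the \<open>(x\<^sub>2, x\<^sub>3)\<close> plane; the level sets of
  \<open>height \<phi>\<close> are the planes over its lines.\<close>

definition height :: "real \<Rightarrow> real^3 \<Rightarrow> real" where
  "height \<phi> x = cos \<phi> * x$2 + sin \<phi> * x$3"

lemma height_diff: "height \<phi> (x - y) = height \<phi> x - height \<phi> y"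
  and height_add: "height \<phi> (x + y) = height \<phi> x + height \<phi> y"
  and height_scale: "height \<phi> (c *\<^sub>R x) = c * height \<phi> x"
  by (simp_all add: height_def algebra_simps)

lemma continuous_on_height [continuous_intros]:
  "continuous_on S g \<Longrightarrow> continuous_on S (\<lambda>x. height \<phi> (g x))"
  unfolding height_def by (intro continuous_intros) auto

lemma measurable_height [measurable]: "height \<phi> \<in> borel_measurable borel"
  by (intro borel_measurable_continuous_onI continuous_intros)

lemma height_rotate: "height \<phi> x = cos (\<phi> - \<psi>) * height \<psi> x + sin (\<phi> - \<psi>) * height (\<psi> + pi/2) x"
proof -
  have c: "cos \<phi> = cos (\<phi> - \<psi>) * cos \<psi> - sin (\<phi> - \<psi>) * sin \<psi>"
    using cos_add[of "\<phi> - \<psi>" \<psi>] by simp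
  have s: "sin \<phi> = sin (\<phi> - \<psi>) * cos \<psi> + cos (\<phi> - \<psi>) * sin \<psi>"
    using sin_add[of "\<phi> - \<psi>" \<psi>] by simp
  have "cos (\<psi> + pi/2) = - sin \<psi>" "sin (\<psi> + pi/2) = cos \<psi>"
    by (simp_all add: cos_add sin_add)
  then show ?thesis unfolding height_def by (subst c, subst s) (simp add: algebra_simps)
qed

lemma norm_sq3: "norm (x::real^3) ^ 2 = (x$1)^2 + (x$2)^2 + (x$3)^2"
  by (simp add: norm_eq_sqrt_inner inner_vec_def sum_3 power2_eq_square)

lemma abs_height_le: "\<bar>height \<phi> x\<bar> \<le> sqrt ((x$2)^2 + (x$3)^2)"
proof -
  have "(height \<phi> x)^2 + (cos \<phi> * x$3 - sin \<phi> * x$2)^2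
      = ((cos \<phi>)^2 + (sin \<phi>)^2) * ((x$2)^2 + (x$3)^2)"
    unfolding height_def by (simp only: power2_eq_square algebra_simps)
  then have "(height \<phi> x)^2 \<le> (x$2)^2 + (x$3)^2"
    by (simp add: sin_cos_squared_add2) (smt (verit) zero_le_power2)
  then show ?thesis by (simp add: real_le_rsqrt abs_le_square_iff real_le_rsqrt)
qed

lemma abs_height_le_norm: "\<bar>height \<phi> x\<bar> \<le> norm x"
proof -
  have "(x$2)^2 + (x$3)^2 \<le> (norm x)^2" by (simp add: norm_sq3)
  then have "sqrt ((x$2)^2 + (x$3)^2) \<le> norm x" by (simp add: real_le_lsqrt)
  then show ?thesis using abs_height_le[of \<phi> x] by linarith
qed

text \<open>Leaving \<open>x\<close> by a step of length \<open>l\<close> that stays \<open>w\<close>-close to a level line of \<open>height \<psi>\<close> changes \<open>height \<phi>\<close>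
  only through the component along that line, which the sine of the angle damps. This is how angles between lines
  are read off from the heights of two points on them.\<close>

lemma height_near_crossing:
  assumes "norm (p - x) \<le> l" "\<bar>height \<psi> p - height \<psi> x\<bar> \<le> w"
  shows "\<bar>height \<phi> p - height \<phi> x\<bar> \<le> w + l * \<bar>sin (\<phi> - \<psi>)\<bar>"
proof -
  have "height \<phi> p - height \<phi> x = height \<phi> (p - x)" by (simp add: height_diff)
  also have "\<dots> = cos (\<phi> - \<psi>) * height \<psi> (p - x) + sin (\<phi> - \<psi>) * height (\<psi> + pi/2) (p - x)"
    by (rule height_rotate)
  also have "\<bar>\<dots>\<bar> \<le> 1 * w + \<bar>sin (\<phi> - \<psi>)\<bar> * l"
  proof -
    have "\<bar>cos (\<phi> - \<psi>)\<bar> * \<bar>height \<psi> (p - x)\<bar> \<le> 1 * w"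
      using assms abs_cos_le_one[of "\<phi> - \<psi>"] by (intro mult_mono) (auto simp: height_diff)
    moreover have "\<bar>sin (\<phi> - \<psi>)\<bar> * \<bar>height (\<psi> + pi/2) (p - x)\<bar> \<le> \<bar>sin (\<phi> - \<psi>)\<bar> * l"
      using assms abs_height_le_norm[of "\<psi> + pi/2" "p - x"] by (intro mult_left_mono) auto
    ultimately show ?thesis by (intro order_trans[OF abs_triangle_ineq] add_mono) (simp_all add: abs_mult)
  qed
  finally show ?thesis by (simp add: mult.commute)
qed

lemma prod_UNIV_3: "prod f (UNIV :: 3 set) = f 1 * f 2 * f 3"
  unfolding UNIV_3 by (simp add: ac_simps)

lemma content_box3:
  assumes "a1 \<le> b1" "a2 \<le> b2" "a3 \<le> b3"
  shows "measure lborel (cbox (vector [a1, a2, a3]) (vector [b1, b2, b3]) :: (real^3) set)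
       = (b1 - a1) * (b2 - a2) * (b3 - a3)"
proof -
  have "cbox (vector [a1, a2, a3]) (vector [b1, b2, b3]) \<noteq> ({} :: (real^3) set)"
    using assms by (simp add: interval_ne_empty_cart forall_3)
  then show ?thesis by (simp add: content_cbox_cart prod_UNIV_3)
qed

text \<open>The bound \<open>3\<close> on the first coordinate makes the set bounded; it matches the support of \<open>cutoff\<close> below.\<close>

definition slab_pair where
  "slab_pair \<phi> \<alpha> \<alpha>' \<psi> \<beta> \<beta>' = {x::real^3. \<bar>x$1\<bar> \<le> 3 \<and> \<alpha> \<le> height \<phi> x \<and> height \<phi> x \<le> \<alpha>' \<and> \<beta> \<le> height \<psi> x \<and> height \<psi> x \<le> \<beta>'}"

text \<open>Solving for \<open>(x\<^sub>1, x\<^sub>2, x\<^sub>3)\<close> in terms of \<open>(x\<^sub>1, height \<phi> x, height \<psi> x)\<close> inverts a \<open>2 \<times> 2\<close> system of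
  determinant \<open>sin (\<psi> - \<phi>)\<close>.\<close>

lemma slab_pair_subset:
  assumes "sin (\<phi> - \<psi>) \<noteq> 0"
  shows "\<exists>H. linear H \<and> \<bar>det (matrix H)\<bar> = 1 / \<bar>sin (\<phi> - \<psi>)\<bar> \<and>
     slab_pair \<phi> \<alpha> \<alpha>' \<psi> \<beta> \<beta>' \<subseteq> H ` cbox (vector [-3, \<alpha>, \<beta>]) (vector [3, \<alpha>', \<beta>'])"
proof -
  define \<Delta> where "\<Delta> = sin (\<psi> - \<phi>)"
  have D0: "\<Delta> \<noteq> 0" using assms sin_minus[of "\<phi> - \<psi>"] unfolding \<Delta>_def by simp
  define H :: "real^3 \<Rightarrow> real^3" where
    "H z = vector [z$1, (z$2 * sin \<psi> - z$3 * sin \<phi>) / \<Delta>, (z$3 * cos \<phi> - z$2 * cos \<psi>) / \<Delta>]" for z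
  have lin: "linear H"
    by (rule linearI) (simp_all add: H_def vec_eq_iff forall_3 algebra_simps add_divide_distrib diff_divide_distrib)
  have Del: "\<Delta> = sin \<psi> * cos \<phi> - cos \<psi> * sin \<phi>" by (simp add: \<Delta>_def sin_diff)
  have det: "det (matrix H) = 1 / \<Delta>"
  proof -
    have "det (matrix H) = (sin \<psi> / \<Delta>) * (cos \<phi> / \<Delta>) - (sin \<phi> / \<Delta>) * (cos \<psi> / \<Delta>)"
      by (simp add: det_3 matrix_def H_def axis_def vector_def)
    also have "\<dots> = \<Delta> / (\<Delta> * \<Delta>)" by (simp add: Del diff_divide_distrib mult.commute)
    finally show ?thesis using D0 by simp
  qed
  have sub: "slab_pair \<phi> \<alpha> \<alpha>' \<psi> \<beta> \<beta>' \<subseteq> H ` cbox (vector [-3, \<alpha>, \<beta>]) (vector [3, \<alpha>', \<beta>'])"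
  proof
    fix x :: "real^3" assume x: "x \<in> slab_pair \<phi> \<alpha> \<alpha>' \<psi> \<beta> \<beta>'"
    define z :: "real^3" where "z = vector [x$1, height \<phi> x, height \<psi> x]"
    have "z \<in> cbox (vector [-3, \<alpha>, \<beta>]) (vector [3, \<alpha>', \<beta>'])"
      using x by (auto simp: z_def slab_pair_def mem_box_cart forall_3)
    moreover have "H z = x"
    proof -
      have "height \<phi> x * sin \<psi> - height \<psi> x * sin \<phi> = x$2 * \<Delta>"
        "height \<psi> x * cos \<phi> - height \<phi> x * cos \<psi> = x$3 * \<Delta>"
        unfolding height_def Del by (simp_all only: algebra_simps)
      then show ?thesis using D0 by (simp add: H_def z_def vec_eq_iff forall_3)
    qed
    ultimately show "x \<in> H ` cbox (vector [-3, \<alpha>, \<beta>]) (vector [3, \<alpha>', \<beta>'])" by (metis imageI)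
  qed
  have "\<bar>det (matrix H)\<bar> = 1 / \<bar>sin (\<phi> - \<psi>)\<bar>"
    using det sin_minus[of "\<phi> - \<psi>"] by (simp add: \<Delta>_def)
  with lin sub show ?thesis by blast
qed

lemma slab_pair_measurable [measurable]: "slab_pair \<phi> \<alpha> \<alpha>' \<psi> \<beta> \<beta>' \<in> sets borel"
proof -
  have "closed (slab_pair \<phi> \<alpha> \<alpha>' \<psi> \<beta> \<beta>')"
    unfolding slab_pair_def by (intro closed_Collect_conj closed_Collect_le continuous_intros)
  then show ?thesis by (rule borel_closed)
qed

lemma measure_slab_pair:
  assumes s: "sin (\<phi> - \<psi>) \<noteq> 0" and "\<alpha> \<le> \<alpha>'" "\<beta> \<le> \<beta>'"
  shows "slab_pair \<phi> \<alpha> \<alpha>' \<psi> \<beta> \<beta>' \<in> lmeasurable"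
    and "measure lborel (slab_pair \<phi> \<alpha> \<alpha>' \<psi> \<beta> \<beta>') \<le> 6 * (\<alpha>' - \<alpha>) * (\<beta>' - \<beta>) / \<bar>sin (\<phi> - \<psi>)\<bar>"
proof -
  let ?c = "cbox (vector [-3, \<alpha>, \<beta>]) (vector [3, \<alpha>', \<beta>']) :: (real^3) set"
  obtain H where H: "linear H" "\<bar>det (matrix H)\<bar> = 1 / \<bar>sin (\<phi> - \<psi>)\<bar>"
     "slab_pair \<phi> \<alpha> \<alpha>' \<psi> \<beta> \<beta>' \<subseteq> H ` ?c" using slab_pair_subset[OF s] by blast
  have mb: "measure lebesgue ?c = 6 * (\<alpha>' - \<alpha>) * (\<beta>' - \<beta>)"
    using assms(2,3) by (simp add: measure_completion content_box3)
  have m: "measure lebesgue (H ` ?c) = \<bar>det (matrix H)\<bar> * measure lebesgue ?c" and mm: "H ` ?c \<in> lmeasurable"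
    using measure_linear_image[OF H(1), of ?c] measurable_linear_image[OF H(1), of ?c] by auto
  have sl: "slab_pair \<phi> \<alpha> \<alpha>' \<psi> \<beta> \<beta>' \<in> sets lebesgue" by (simp add: sets_completionI_sets)
  show "slab_pair \<phi> \<alpha> \<alpha>' \<psi> \<beta> \<beta>' \<in> lmeasurable"
    using sl mm H(3) fmeasurableI2 by blast
  have "measure lebesgue (slab_pair \<phi> \<alpha> \<alpha>' \<psi> \<beta> \<beta>') \<le> measure lebesgue (H ` ?c)"
    using measure_mono_fmeasurable[OF H(3) sl mm] .
  then show "measure lborel (slab_pair \<phi> \<alpha> \<alpha>' \<psi> \<beta> \<beta>') \<le> 6 * (\<alpha>' - \<alpha>) * (\<beta>' - \<beta>) / \<bar>sin (\<phi> - \<psi>)\<bar>"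
    unfolding m mb H(2) by (simp add: measure_completion)
qed

section \<open>The oscillation of a strip about its coarse average\<close>

definition strip :: "real \<Rightarrow> real \<Rightarrow> real" where
  "strip s u = indicat_real {-s..<s} u"

text \<open>The strip profile spread over \<open>M\<close> times its width, normalised to keep its integral.\<close>

definition wide :: "real \<Rightarrow> nat \<Rightarrow> real \<Rightarrow> real" where
  "wide s M u = indicat_real {-s..<(2 * real M - 1) * s} u / real M"

text \<open>The part of a strip that is seen at scales between \<open>s\<close> and \<open>M * s\<close> only.\<close>

definition osc :: "real \<Rightarrow> nat \<Rightarrow> real \<Rightarrow> real" where
  "osc s M u = strip s u - wide s M u"

text \<open>A weight that is at least \<open>1\<close> on \<open>cball 0 2\<close>. It is Lipschitz, unlike an indicator function, and this is what makes
  the interaction of two crossing strips cancel.\<close>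

definition cutoff :: "real^3 \<Rightarrow> real" where
  "cutoff x = max 0 (3 - norm x)"

lemma measurable_profiles [measurable]:
  "strip s \<in> borel_measurable borel" "wide s M \<in> borel_measurable borel"
  "osc s M \<in> borel_measurable borel" "cutoff \<in> borel_measurable borel"
  unfolding strip_def[abs_def] wide_def[abs_def] osc_def[abs_def] cutoff_def[abs_def] by measurable

lemma strip_bounds: "0 \<le> strip s u" "strip s u \<le> 1"
  by (auto simp: strip_def indicator_def)

lemma wide_bounds: "0 \<le> wide s M u" "wide s M u \<le> 1 / real M"
  by (auto simp: wide_def indicator_def divide_right_mono)

lemma wide_1: "wide s 1 u = strip s u"
  by (simp add: wide_def strip_def)

text \<open>The translates by multiples of \<open>2 * s\<close> tile the wide interval. Being an average of translates is the property of
  \<open>wide\<close> from which all cancellation comes.\<close>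

lemma wide_eq_average:
  assumes "0 < s"
  shows "wide s M u = (\<Sum>m<M. strip s (u - 2 * s * real m)) / real M"
proof -
  have "(\<Sum>m<M. strip s (u - 2 * s * real m)) = indicat_real {-s..<(2 * real M - 1) * s} u"
  proof (induction M)
    case 0
    then show ?case using assms by (simp add: indicator_def)
  next
    case (Suc M)
    define K where "K = 2 * s * real M"
    have K: "(2 * real M - 1) * s = K - s" "(2 * real (Suc M) - 1) * s = K + s"
      by (simp_all add: K_def algebra_simps)
    have "0 \<le> K" using assms by (simp add: K_def)
    then show ?case using assms unfolding sum.lessThan_Suc Suc.IH K K_def[symmetric]
      by (auto simp: strip_def indicator_def)
  qed
  then show ?thesis by (simp add: wide_def)
qed

lemma osc_support:
  assumes "osc s M u \<noteq> 0" "0 < s" "1 \<le> M"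
  shows "\<bar>u\<bar> \<le> 2 * (real M * s)"
proof -
  have "s \<le> real M * s" using assms by simp
  moreover have "-s \<le> u" "u < s \<or> u < (2 * real M - 1) * s"
    using assms(1) by (cases "-s \<le> u"; cases "u < s"; auto simp: osc_def strip_def wide_def indicator_def)+
  moreover have "(2 * real M - 1) * s = 2 * (real M * s) - s" by (simp add: algebra_simps)
  ultimately show ?thesis using assms(2) by linarith
qed

lemma abs_osc_le_1: "1 \<le> M \<Longrightarrow> \<bar>osc s M u\<bar> \<le> 1"
proof -
  assume "1 \<le> M"
  then have "1 / real M \<le> 1" by simp
  then show ?thesis using strip_bounds[of s u] wide_bounds[of s M u] unfolding osc_def by linarith
qed

lemma cutoff_bounds: "0 \<le> cutoff x" "cutoff x \<le> 3"
  by (auto simp: cutoff_def)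

lemma cutoff_lipschitz: "\<bar>cutoff x - cutoff y\<bar> \<le> norm (x - y)"
  unfolding cutoff_def using norm_triangle_ineq2[of x y] norm_triangle_ineq2[of y x]
  by (auto simp: norm_minus_commute)

lemma integrable_cutoff:
  assumes [measurable]: "u \<in> borel_measurable borel" and "\<And>x. \<bar>u x\<bar> \<le> B"
  shows "integrable lborel (\<lambda>x. cutoff x * u x)"
proof (rule integrableI_bounded_set)
  show "cball (0::real^3) 3 \<in> sets lborel" by simp
  show "emeasure lborel (cball (0::real^3) 3) < \<infinity>" by (rule emeasure_lborel_cball_finite)
  show "AE x\<in>cball 0 3 in lborel. norm (cutoff x * u x) \<le> 3 * B"
    using assms(2) cutoff_bounds by (auto simp: abs_mult intro!: AE_I2 mult_mono)
  show "AE x in lborel. x \<notin> cball 0 3 \<longrightarrow> cutoff x * u x = 0"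
    by (auto simp: cutoff_def)
qed measurable

lemma integral_le_measure:
  fixes f :: "real^3 \<Rightarrow> real"
  assumes "integrable lborel f" "S \<in> lmeasurable" "S \<in> sets borel" "\<And>x. f x \<le> c * indicator S x"
  shows "integral\<^sup>L lborel f \<le> c * measure lborel S"
proof -
  have fin: "emeasure lborel S < \<infinity>"
    using assms(2,3) by (simp add: fmeasurable_def)
  have "integral\<^sup>L lborel f \<le> (\<integral>x. c * indicator S x \<partial>lborel)"
    using assms fin by (intro integral_mono) auto
  then show ?thesis by simp
qed

definition bounded_slab where
  "bounded_slab \<phi> \<alpha> \<alpha>' = slab_pair (\<phi> + pi/2) (-3) 3 \<phi> \<alpha> \<alpha>'"

lemma bounded_slab:
  assumes "\<alpha> \<le> \<alpha>'"
  shows "bounded_slab \<phi> \<alpha> \<alpha>' \<in> lmeasurable" "bounded_slab \<phi> \<alpha> \<alpha>' \<in> sets borel"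
    "measure lborel (bounded_slab \<phi> \<alpha> \<alpha>') \<le> 36 * (\<alpha>' - \<alpha>)"
  using measure_slab_pair[of "\<phi> + pi/2" \<phi> "-3" 3 \<alpha> \<alpha>'] assms by (auto simp: bounded_slab_def)

lemma in_bounded_slab:
  assumes "norm x \<le> 3" "\<alpha> \<le> height \<phi> x" "height \<phi> x \<le> \<alpha>'"
  shows "x \<in> bounded_slab \<phi> \<alpha> \<alpha>'"
  using assms abs_height_le_norm[of "\<phi> + pi/2" x] component_le_norm_cart[of x 1]
  by (auto simp: bounded_slab_def slab_pair_def)

lemma integral_cutoff_le:
  assumes [measurable]: "u \<in> borel_measurable borel" and B: "\<And>x. \<bar>u x\<bar> \<le> B"
    and S: "S \<in> lmeasurable" "S \<in> sets borel" and "0 \<le> c"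
    and u: "\<And>x. norm x \<le> 3 \<Longrightarrow> u x \<le> c * indicator S x" "\<And>x. 0 \<le> u x"
  shows "(\<integral>x. cutoff x * u x \<partial>lborel) \<le> 3 * c * measure lborel S"
proof (rule integral_le_measure[OF integrable_cutoff[OF assms(1) B] S])
  fix x
  show "cutoff x * u x \<le> 3 * c * indicator S x"
  proof (cases "norm x \<le> 3")
    case True
    then show ?thesis using mult_mono[OF cutoff_bounds(2) u(1)[OF True]] u(2) by (simp add: mult.assoc)
  next
    case False
    then show ?thesis using \<open>0 \<le> c\<close> by (simp add: cutoff_def)
  qed
qed

text \<open>The weighted \<open>L\<^sup>2\<close> inner product of the oscillating parts of two strips.\<close>

definition energy :: "real \<Rightarrow> nat \<Rightarrow> real \<Rightarrow> real \<Rightarrow> real \<Rightarrow> real \<Rightarrow> real" where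
  "energy s M \<phi> t \<psi> t' = (\<integral>x. cutoff x * (osc s M (height \<phi> x - t) * osc s M (height \<psi> x - t')) \<partial>lborel)"

text \<open>For lines that are close at scale \<open>M * s\<close> there is nothing to gain from cancellation, and size bounds suffice. The
  parameter \<open>D\<close> measures how far the second line is from the first within the region of interest; by \<open>cross\<close>, if
  the strips meet and \<open>D\<close> is well above \<open>s\<close>, then their angle is at least about \<open>D\<close>, so that they meet in measure about \<open>s\<^sup>2 / D\<close>. Terms
  with a wide profile are at most about \<open>s / M\<close>.\<close>

lemma energy_near:
  assumes s: "0 < s" and M: "1 \<le> M" and D: "s \<le> D" "D \<le> 8 * (real M * s)"
    and cross: "\<And>x w. norm x \<le> 3 \<Longrightarrow> s \<le> w \<Longrightarrow> \<bar>height \<phi> x - t\<bar> \<le> w \<Longrightarrow> \<bar>height \<psi> x - t'\<bar> \<le> w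
       \<Longrightarrow> D \<le> 2 * w + 5 * \<bar>sin (\<phi> - \<psi>)\<bar>"
  shows "\<bar>energy s M \<phi> t \<psi> t'\<bar> \<le> 6048 * s\<^sup>2 / D"
proof -
  define fi where "fi x = strip s (height \<phi> x - t)" for x
  define fj where "fj x = strip s (height \<psi> x - t')" for x
  define gi where "gi x = wide s M (height \<phi> x - t)" for x
  define gj where "gj x = wide s M (height \<psi> x - t')" for x
  have [measurable]: "fi \<in> borel_measurable borel" "fj \<in> borel_measurable borel"
    "gi \<in> borel_measurable borel" "gj \<in> borel_measurable borel"
    unfolding fi_def[abs_def] fj_def[abs_def] gi_def[abs_def] gj_def[abs_def] by measurable
  have M0: "0 < real M" "1 / real M \<le> 1" using M by auto
  have b: "0 \<le> fi x" "fi x \<le> 1" "0 \<le> fj x" "fj x \<le> 1" "0 \<le> gi x" "gi x \<le> 1 / M" "0 \<le> gj x" "gj x \<le> 1 / M" for x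
    unfolding fi_def fj_def gi_def gj_def using strip_bounds wide_bounds by auto
  have b1: "gi x \<le> 1" "gj x \<le> 1" for x using b[of x] M0 by linarith+
  have prods: "\<bar>fi x * fj x\<bar> \<le> 1" "\<bar>fi x * gj x\<bar> \<le> 1" "\<bar>gi x * fj x\<bar> \<le> 1" "\<bar>gi x * gj x\<bar> \<le> 1" for x
    using b[of x] b1[of x] by (auto simp: abs_mult intro!: mult_le_one)
  note ints = integrable_cutoff[OF _ prods(1)] integrable_cutoff[OF _ prods(2)]
    integrable_cutoff[OF _ prods(3)] integrable_cutoff[OF _ prods(4)]
  have D0: "0 < D" using s D by simp
  let ?Si = "bounded_slab \<phi> (t - s) (t + s)" and ?Sj = "bounded_slab \<psi> (t' - s) (t' + s)"
  let ?Wj = "bounded_slab \<psi> (t' - s) (t' + (2 * real M - 1) * s)"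
  have Ms: "s \<le> real M * s" using M s by simp
  have fS: "fi x \<le> indicator ?Si x" "fj x \<le> indicator ?Sj x" "gj x \<le> (1 / M) * indicator ?Wj x" if "norm x \<le> 3" for x
    using that by (auto simp: fi_def fj_def gj_def strip_def wide_def indicator_def in_bounded_slab)
  have I1: "(\<integral>x. cutoff x * (fi x * fj x) \<partial>lborel) \<le> 864 * s\<^sup>2 / D"
  proof (cases "D \<le> 4 * s")
    case True
    have "(\<integral>x. cutoff x * (fi x * fj x) \<partial>lborel) \<le> 3 * 1 * measure lborel ?Si"
    proof (rule integral_cutoff_le[OF _ prods(1)])
      fix x :: "real^3" assume "norm x \<le> 3"
      show "fi x * fj x \<le> 1 * indicator ?Si x"
        using mult_mono[OF fS(1)[OF \<open>norm x \<le> 3\<close>] b(4)[of x]] b[of x] by simp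
    qed (use s b bounded_slab in auto)
    also have "\<dots> \<le> 216 * s" using bounded_slab(3)[of "t - s" "t + s" \<phi>] s by simp
    also have "\<dots> \<le> 864 * s\<^sup>2 / D" using True D0 s by (simp add: field_simps power2_eq_square)
    finally show ?thesis .
  next
    case False
    show ?thesis
    proof (cases "\<bar>sin (\<phi> - \<psi>)\<bar> < D / 10")
      case True
      have "cutoff x * (fi x * fj x) = 0" for x
      proof (rule ccontr)
        assume "cutoff x * (fi x * fj x) \<noteq> 0"
        then have "norm x \<le> 3" "\<bar>height \<phi> x - t\<bar> \<le> s" "\<bar>height \<psi> x - t'\<bar> \<le> s"
          by (auto simp: cutoff_def fi_def fj_def strip_def indicator_def split: if_splits)
        from cross[OF this(1) order_refl this(2,3)] show False using False True by simp
      qed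
      then have "(\<integral>x. cutoff x * (fi x * fj x) \<partial>lborel) = 0" by (simp only: integral_zero)
      then show ?thesis using D0 by simp
    next
      case sn: False
      then have sn0: "sin (\<phi> - \<psi>) \<noteq> 0" using D0 by auto
      let ?P = "slab_pair \<phi> (t - s) (t + s) \<psi> (t' - s) (t' + s)"
      have "(\<integral>x. cutoff x * (fi x * fj x) \<partial>lborel) \<le> 3 * 1 * measure lborel ?P"
      proof (rule integral_cutoff_le[OF _ prods(1)])
        fix x :: "real^3" assume x: "norm x \<le> 3"
        have "\<bar>x $ 1\<bar> \<le> 3" using component_le_norm_cart[of x 1] x by linarith
        then show "fi x * fj x \<le> 1 * indicator ?P x"
          by (auto simp: fi_def fj_def strip_def indicator_def slab_pair_def)
      qed (use s b measure_slab_pair[OF sn0] in auto)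
      also have "\<dots> \<le> 72 * s\<^sup>2 / \<bar>sin (\<phi> - \<psi>)\<bar>"
        using measure_slab_pair(2)[OF sn0, of "t - s" "t + s" "t' - s" "t' + s"] s
        by (simp add: power2_eq_square)
      also have "\<dots> \<le> 72 * s\<^sup>2 / (D / 10)" using sn D0 by (intro divide_left_mono) auto
      also have "\<dots> \<le> 864 * s\<^sup>2 / D" using D0 by (simp add: field_simps)
      finally show ?thesis .
    qed
  qed
  have rho: "216 * s / M \<le> 1728 * s\<^sup>2 / D" using D D0 M0 s by (simp add: field_simps power2_eq_square)
  have mSi: "measure lborel ?Si \<le> 72 * s" "measure lborel ?Sj \<le> 72 * s"
    using bounded_slab(3)[of "t - s" "t + s" \<phi>] bounded_slab(3)[of "t' - s" "t' + s" \<psi>] s by auto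
  have mWj: "measure lborel ?Wj \<le> 72 * (M * s)"
    using bounded_slab(3)[of "t' - s" "t' + (2 * real M - 1) * s" \<psi>] s Ms by (simp add: algebra_simps)
  have I2: "(\<integral>x. cutoff x * (fi x * gj x) \<partial>lborel) \<le> 216 * s / M"
  proof -
    have "(\<integral>x. cutoff x * (fi x * gj x) \<partial>lborel) \<le> 3 * (1 / M) * measure lborel ?Si"
    proof (rule integral_cutoff_le[OF _ prods(2)])
      fix x :: "real^3" assume "norm x \<le> 3"
      show "fi x * gj x \<le> (1 / M) * indicator ?Si x"
        using mult_mono[OF fS(1)[OF \<open>norm x \<le> 3\<close>] b(8)[of x]] b[of x] by (simp add: mult.commute)
    qed (use s b bounded_slab in auto)
    also have "\<dots> \<le> 3 * (1 / M) * (72 * s)" using mSi M0 by (intro mult_left_mono) auto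
    finally show ?thesis by simp
  qed
  have I3: "(\<integral>x. cutoff x * (gi x * fj x) \<partial>lborel) \<le> 216 * s / M"
  proof -
    have "(\<integral>x. cutoff x * (gi x * fj x) \<partial>lborel) \<le> 3 * (1 / M) * measure lborel ?Sj"
    proof (rule integral_cutoff_le[OF _ prods(3)])
      fix x :: "real^3" assume "norm x \<le> 3"
      show "gi x * fj x \<le> (1 / M) * indicator ?Sj x"
        using mult_mono[OF b(6)[of x] fS(2)[OF \<open>norm x \<le> 3\<close>]] b[of x] by simp
    qed (use s b bounded_slab in auto)
    also have "\<dots> \<le> 3 * (1 / M) * (72 * s)" using mSi M0 by (intro mult_left_mono) auto
    finally show ?thesis by simp
  qed
  have I4: "(\<integral>x. cutoff x * (gi x * gj x) \<partial>lborel) \<le> 216 * s / M"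
  proof -
    have "(\<integral>x. cutoff x * (gi x * gj x) \<partial>lborel) \<le> 3 * (1 / M * (1 / M)) * measure lborel ?Wj"
    proof (rule integral_cutoff_le[OF _ prods(4)])
      fix x :: "real^3" assume "norm x \<le> 3"
      show "gi x * gj x \<le> (1 / M * (1 / M)) * indicator ?Wj x"
        using mult_mono[OF b(6)[of x] fS(3)[OF \<open>norm x \<le> 3\<close>]] b[of x] by simp
    next
      show "?Wj \<in> lmeasurable" "?Wj \<in> sets borel"
        using bounded_slab[of "t' - s" "t' + (2 * real M - 1) * s" \<psi>] s Ms by (auto simp: algebra_simps)
    qed (use s b bounded_slab Ms in auto)
    also have "\<dots> \<le> 3 * (1 / M * (1 / M)) * (72 * (M * s))" using mWj M0 by (intro mult_left_mono) auto
    finally show ?thesis using M0 by simp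
  qed
  have "\<bar>energy s M \<phi> t \<psi> t'\<bar> \<le> (\<integral>x. \<bar>cutoff x * (osc s M (height \<phi> x - t) * osc s M (height \<psi> x - t'))\<bar> \<partial>lborel)"
    unfolding energy_def using integral_norm_bound[of lborel "\<lambda>x. cutoff x * (osc s M (height \<phi> x - t) * osc s M (height \<psi> x - t'))"]
    by simp
  also have "\<dots> \<le> (\<integral>x. cutoff x * (fi x * fj x) + cutoff x * (fi x * gj x) + cutoff x * (gi x * fj x) + cutoff x * (gi x * gj x) \<partial>lborel)"
  proof (rule integral_mono)
    show "integrable lborel (\<lambda>x. \<bar>cutoff x * (osc s M (height \<phi> x - t) * osc s M (height \<psi> x - t'))\<bar>)"
      by (intro integrable_abs integrable_cutoff[where B = 1])
         (use abs_osc_le_1[OF M] in \<open>auto simp: abs_mult intro!: mult_le_one\<close>)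
    show "integrable lborel (\<lambda>x. cutoff x * (fi x * fj x) + cutoff x * (fi x * gj x) + cutoff x * (gi x * fj x) + cutoff x * (gi x * gj x))"
      using ints by simp
    fix x
    have "\<bar>osc s M (height \<phi> x - t)\<bar> \<le> fi x + gi x" "\<bar>osc s M (height \<psi> x - t')\<bar> \<le> fj x + gj x"
      using b[of x] by (auto simp: osc_def fi_def gi_def fj_def gj_def abs_le_iff)
    then have "\<bar>osc s M (height \<phi> x - t) * osc s M (height \<psi> x - t')\<bar> \<le> (fi x + gi x) * (fj x + gj x)"
      unfolding abs_mult by (intro mult_mono) (use b[of x] in auto)
    then have "cutoff x * \<bar>osc s M (height \<phi> x - t) * osc s M (height \<psi> x - t')\<bar> \<le> cutoff x * ((fi x + gi x) * (fj x + gj x))"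
      using cutoff_bounds by (intro mult_left_mono) auto
    then show "\<bar>cutoff x * (osc s M (height \<phi> x - t) * osc s M (height \<psi> x - t'))\<bar>
        \<le> cutoff x * (fi x * fj x) + cutoff x * (fi x * gj x) + cutoff x * (gi x * fj x) + cutoff x * (gi x * gj x)"
      using cutoff_bounds(1)[of x] by (simp add: abs_mult algebra_simps)
  qed
  also have "\<dots> = (\<integral>x. cutoff x * (fi x * fj x) \<partial>lborel) + (\<integral>x. cutoff x * (fi x * gj x) \<partial>lborel)
     + (\<integral>x. cutoff x * (gi x * fj x) \<partial>lborel) + (\<integral>x. cutoff x * (gi x * gj x) \<partial>lborel)"
    using ints by simp
  also have "\<dots> \<le> 864 * s\<^sup>2 / D + 216 * s / M + 216 * s / M + 216 * s / M"
    using I1 I2 I3 I4 by linarith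
  also have "\<dots> \<le> 6048 * s\<^sup>2 / D" using rho by simp
  finally show ?thesis .
qed

text \<open>The direction of the level lines of \<open>height \<psi>\<close>.\<close>

definition line_dir :: "real \<Rightarrow> real^3" where
  "line_dir \<psi> = vector [0, - sin \<psi>, cos \<psi>]"

lemma line_dir: "height \<psi> (line_dir \<psi>) = 0" "height \<phi> (line_dir \<psi>) = sin (\<phi> - \<psi>)"
  "norm (line_dir \<psi>) = 1" "line_dir \<psi> $ 1 = 0"
proof -
  have "norm (line_dir \<psi>) ^ 2 = 1" by (simp add: norm_sq3 line_dir_def)
  then show "norm (line_dir \<psi>) = 1"
    using norm_ge_zero[of "line_dir \<psi>"] by (simp add: power2_eq_1_iff)
qed (simp_all add: height_def line_dir_def sin_diff)

lemma integral_shift: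
  fixes f :: "real^3 \<Rightarrow> real"
  assumes [measurable]: "f \<in> borel_measurable borel"
  shows "(\<integral>x. f (v + x) \<partial>lborel) = integral\<^sup>L lborel f"
proof -
  have "integral\<^sup>L lborel f = integral\<^sup>L (distr lborel borel ((+) v)) f" by (simp add: lborel_distr_plus)
  also have "\<dots> = (\<integral>x. f (v + x) \<partial>lborel)" by (rule integral_distr) auto
  finally show ?thesis by simp
qed

text \<open>Translating the first strip across itself by \<open>v\<close> has the same effect, near the second strip, as translating
  everything along the second line by \<open>v / sin (\<phi> - \<psi>)\<close>. The second profile does not notice this, so after a change
  of variables only the increment of the Lipschitz weight remains, integrated over the parallelogram in which the
  strips meet.\<close>

lemma energy_shift_le:
  assumes s: "0 < s" and M: "1 \<le> M" and sn: "sin (\<phi> - \<psi>) \<noteq> 0" and v: "0 \<le> v" "v \<le> 2 * (real M * s)"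
  shows "\<bar>\<integral>x. cutoff x * ((strip s (height \<phi> x - t) - strip s (height \<phi> x - t - v)) * osc s M (height \<psi> x - t')) \<partial>lborel\<bar>
    \<le> 96 * (real M * s) * s\<^sup>2 / (sin (\<phi> - \<psi>))\<^sup>2"
proof -
  \<comment> \<open>moving by \<open>d\<close> along the second line raises \<open>height \<phi>\<close> by \<open>v\<close>\<close>
  define \<tau> where "\<tau> = v / sin (\<phi> - \<psi>)"
  define d where "d = \<tau> *\<^sub>R line_dir \<psi>"
  define f where "f x = strip s (height \<phi> x - t)" for x
  define h where "h x = osc s M (height \<psi> x - t')" for x
  have [measurable]: "f \<in> borel_measurable borel" "h \<in> borel_measurable borel"
    unfolding f_def[abs_def] h_def[abs_def] by measurable
  have dd: "height \<psi> (d + x) = height \<psi> x" "height \<phi> (d + x) = v + height \<phi> x" "(d + x) $ 1 = x $ 1" "norm d = \<bar>\<tau>\<bar>" for x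
    using sn by (simp_all add: d_def height_add height_scale line_dir \<tau>_def)
  have fb: "\<bar>strip s u\<bar> \<le> 1" for u using strip_bounds[of s u] by auto
  have hb: "\<bar>h x\<bar> \<le> 1" for x unfolding h_def by (rule abs_osc_le_1[OF M])
  have fh: "\<bar>f x * h x\<bar> \<le> 1" "\<bar>strip s (height \<phi> x - t - v) * h x\<bar> \<le> 1" for x
    using hb[of x] fb by (auto simp: abs_mult f_def intro!: mult_le_one)
  have i1: "integrable lborel (\<lambda>x. cutoff x * (f x * h x))" by (rule integrable_cutoff[OF _ fh(1)]) measurable
  have i2: "integrable lborel (\<lambda>x. cutoff x * (strip s (height \<phi> x - t - v) * h x))" by (rule integrable_cutoff[OF _ fh(2)]) measurable
  have i3: "integrable lborel (\<lambda>x. cutoff (d + x) * (f x * h x))"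
  proof -
    have "integrable (distr lborel borel ((+) d)) (\<lambda>x. cutoff x * (strip s (height \<phi> x - t - v) * h x))"
      using i2 by (simp add: lborel_distr_plus)
    then have "integrable lborel (\<lambda>x. cutoff (d + x) * (strip s (height \<phi> (d + x) - t - v) * h (d + x)))"
      by (subst (asm) integrable_distr_eq) auto
    then show ?thesis by (simp add: dd h_def f_def)
  qed
  have shift: "(\<integral>x. cutoff x * (strip s (height \<phi> x - t - v) * h x) \<partial>lborel) = (\<integral>x. cutoff (d + x) * (f x * h x) \<partial>lborel)"
    using integral_shift[of "\<lambda>x. cutoff x * (strip s (height \<phi> x - t - v) * h x)" d]
    by (simp add: dd h_def f_def)
  let ?P = "slab_pair \<phi> (t - s) (t + s) \<psi> (t' - s) (t' + s)"
  let ?R = "slab_pair \<phi> (t - s) (t + s) \<psi> (t' - s) (t' + (2 * real M - 1) * s)"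
  have Ms: "s \<le> real M * s" using M s by simp
  have P: "?P \<in> lmeasurable" "measure lborel ?P \<le> 24 * s\<^sup>2 / \<bar>sin (\<phi> - \<psi>)\<bar>"
    using measure_slab_pair[OF sn, of "t - s" "t + s" "t' - s" "t' + s"] s by (auto simp: power2_eq_square)
  have R: "?R \<in> lmeasurable" "measure lborel ?R \<le> 24 * (M * s) * s / \<bar>sin (\<phi> - \<psi>)\<bar>"
    using measure_slab_pair[OF sn, of "t - s" "t + s" "t' - s" "t' + (2 * real M - 1) * s"] s Ms by (auto simp: algebra_simps)
  have finP: "emeasure lborel ?P < \<infinity>" "emeasure lborel ?R < \<infinity>"
    using P(1) R(1) by (auto simp: fmeasurable_def)
  have pw: "\<bar>(cutoff x - cutoff (d + x)) * (f x * h x)\<bar> \<le> \<bar>\<tau>\<bar> * (indicator ?P x + indicator ?R x / M)" for x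
  proof (cases "\<bar>x $ 1\<bar> \<le> 3")
    case True
    have "\<bar>f x * h x\<bar> \<le> indicator ?P x + indicator ?R x / M"
    proof -
      have "\<bar>f x * h x\<bar> \<le> f x * strip s (height \<psi> x - t') + f x * wide s M (height \<psi> x - t')"
        using strip_bounds[of s "height \<psi> x - t'"] wide_bounds[of s M "height \<psi> x - t'"] strip_bounds[of s "height \<phi> x - t"]
        by (auto simp: f_def h_def osc_def abs_mult simp flip: distrib_left intro!: mult_left_mono)
      also have "\<dots> \<le> indicator ?P x + indicator ?R x / M"
        using True by (auto simp: f_def strip_def wide_def slab_pair_def indicator_def)
      finally show ?thesis .
    qed
    moreover have "\<bar>cutoff x - cutoff (d + x)\<bar> \<le> \<bar>\<tau>\<bar>"
      using cutoff_lipschitz[of x "d + x"] dd(4) by simp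
    ultimately show ?thesis unfolding abs_mult by (intro mult_mono) auto
  next
    case False
    then have "norm x > 3" "norm (d + x) > 3"
      using component_le_norm_cart[of x 1] component_le_norm_cart[of "d + x" 1] dd(3)[of x] by auto
    then show ?thesis by (simp add: cutoff_def)
  qed
  have "(\<integral>x. cutoff x * ((f x - strip s (height \<phi> x - t - v)) * h x) \<partial>lborel)
      = (\<integral>x. cutoff x * (f x * h x) - cutoff x * (strip s (height \<phi> x - t - v) * h x) \<partial>lborel)"
    by (simp add: algebra_simps)
  also have "\<dots> = (\<integral>x. (cutoff x - cutoff (d + x)) * (f x * h x) \<partial>lborel)"
    using i1 i2 i3 shift by (simp add: left_diff_distrib)
  also have "\<bar>\<dots>\<bar> \<le> (\<integral>x. \<bar>(cutoff x - cutoff (d + x)) * (f x * h x)\<bar> \<partial>lborel)"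
    using integral_norm_bound[of lborel "\<lambda>x. (cutoff x - cutoff (d + x)) * (f x * h x)"] by simp
  also have "\<dots> \<le> (\<integral>x. \<bar>\<tau>\<bar> * (indicator ?P x + indicator ?R x / M) \<partial>lborel)"
  proof (rule integral_mono)
    have "integrable lborel (\<lambda>x. (cutoff x - cutoff (d + x)) * (f x * h x))"
      using Bochner_Integration.integrable_diff[OF i1 i3] by (simp add: left_diff_distrib)
    then show "integrable lborel (\<lambda>x. \<bar>(cutoff x - cutoff (d + x)) * (f x * h x)\<bar>)" by (rule integrable_abs)
    show "integrable lborel (\<lambda>x. \<bar>\<tau>\<bar> * (indicator ?P x + indicator ?R x / M))"
      using finP by auto
  qed (use pw in auto)
  also have "\<dots> = \<bar>\<tau>\<bar> * (measure lborel ?P + measure lborel ?R / M)"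
    using finP by simp
  also have "\<dots> \<le> \<bar>\<tau>\<bar> * (48 * s\<^sup>2 / \<bar>sin (\<phi> - \<psi>)\<bar>)"
  proof (intro mult_left_mono)
    have "measure lborel ?R / M \<le> 24 * (M * s) * s / \<bar>sin (\<phi> - \<psi>)\<bar> / M"
      using R by (intro divide_right_mono) auto
    also have "\<dots> = 24 * s\<^sup>2 / \<bar>sin (\<phi> - \<psi>)\<bar>" using M by (simp add: power2_eq_square)
    finally show "measure lborel ?P + measure lborel ?R / M \<le> 48 * s\<^sup>2 / \<bar>sin (\<phi> - \<psi>)\<bar>"
      using P(2) by simp
  qed simp
  also have "\<dots> \<le> (2 * (M * s) / \<bar>sin (\<phi> - \<psi>)\<bar>) * (48 * s\<^sup>2 / \<bar>sin (\<phi> - \<psi>)\<bar>)"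
    using v by (intro mult_right_mono) (auto simp: \<tau>_def intro!: divide_right_mono)
  also have "\<dots> = 96 * (real M * s) * s\<^sup>2 / (sin (\<phi> - \<psi>))\<^sup>2" by (simp add: power2_eq_square)
  finally show ?thesis by (simp add: f_def h_def)
qed

text \<open>Averaging the previous bound over the translates that make up \<open>wide\<close>.\<close>

lemma energy_transversal:
  assumes s: "0 < s" and M: "1 \<le> M" and sn: "sin (\<phi> - \<psi>) \<noteq> 0"
  shows "\<bar>energy s M \<phi> t \<psi> t'\<bar> \<le> 96 * (real M * s) * s\<^sup>2 / (sin (\<phi> - \<psi>))\<^sup>2"
proof -
  let ?B = "96 * (real M * s) * s\<^sup>2 / (sin (\<phi> - \<psi>))\<^sup>2"
  let ?F = "\<lambda>m x. cutoff x * ((strip s (height \<phi> x - t) - strip s (height \<phi> x - t - 2 * s * real m)) * osc s M (height \<psi> x - t'))"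
  have int: "integrable lborel (?F m)" for m
  proof (rule integrable_cutoff[where B = 1])
    fix x
    have "\<bar>strip s (height \<phi> x - t) - strip s (height \<phi> x - t - 2 * s * real m)\<bar> \<le> 1"
      by (auto simp: strip_def indicator_def)
    then show "\<bar>(strip s (height \<phi> x - t) - strip s (height \<phi> x - t - 2 * s * real m)) * osc s M (height \<psi> x - t')\<bar> \<le> 1"
      using abs_osc_le_1[OF M] by (auto simp: abs_mult intro!: mult_le_one)
  qed measurable
  have osc_eq: "osc s M u = (\<Sum>m<M. strip s u - strip s (u - 2 * s * real m)) / M" for u
    unfolding osc_def wide_eq_average[OF s] using M by (simp add: sum_subtractf field_simps)
  have "energy s M \<phi> t \<psi> t' = (\<integral>x. (\<Sum>m<M. ?F m x) / M \<partial>lborel)"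
    unfolding energy_def
    by (subst osc_eq) (simp add: sum_distrib_left sum_distrib_right sum_divide_distrib mult.assoc)
  also have "\<dots> = (\<Sum>m<M. integral\<^sup>L lborel (?F m)) / M"
    using int by simp
  finally have "\<bar>energy s M \<phi> t \<psi> t'\<bar> = \<bar>\<Sum>m<M. integral\<^sup>L lborel (?F m)\<bar> / M" by simp
  also have "\<dots> \<le> (\<Sum>m<M. ?B) / M"
  proof (intro divide_right_mono order_trans[OF sum_abs] sum_mono)
    fix m assume "m \<in> {..<M}"
    then have "s * real m \<le> s * real M" using s by simp
    then show "\<bar>integral\<^sup>L lborel (?F m)\<bar> \<le> ?B"
      using s by (intro energy_shift_le[OF s M sn]) (auto simp: algebra_simps)
  qed simp
  also have "\<dots> = ?B" using M by simp
  finally show ?thesis .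
qed

text \<open>Either the two wide strips do not meet where the weight is positive and the energy vanishes, or they cross at an
  angle of at least about \<open>D\<close> and cancel. The gain over \<open>s\<^sup>2 / D\<close> is the factor \<open>M * s / D\<close>.\<close>

lemma energy_far:
  assumes s: "0 < s" and M: "1 \<le> M" and D: "8 * (real M * s) < D"
    and cross: "\<And>x w. norm x \<le> 3 \<Longrightarrow> s \<le> w \<Longrightarrow> \<bar>height \<phi> x - t\<bar> \<le> w \<Longrightarrow> \<bar>height \<psi> x - t'\<bar> \<le> w
       \<Longrightarrow> D \<le> 2 * w + 5 * \<bar>sin (\<phi> - \<psi>)\<bar>"
  shows "\<bar>energy s M \<phi> t \<psi> t'\<bar> \<le> 9600 * (real M * s) * s\<^sup>2 / D\<^sup>2"
proof -
  have Ms: "s \<le> real M * s" using M s by simp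
  have D0: "0 < D" using D s Ms by linarith
  show ?thesis
  proof (cases "\<bar>sin (\<phi> - \<psi>)\<bar> < D / 10")
    case True
    have "cutoff x * (osc s M (height \<phi> x - t) * osc s M (height \<psi> x - t')) = 0" for x
    proof (rule ccontr)
      assume "cutoff x * (osc s M (height \<phi> x - t) * osc s M (height \<psi> x - t')) \<noteq> 0"
      then have "norm x \<le> 3" "\<bar>height \<phi> x - t\<bar> \<le> 2 * (M * s)" "\<bar>height \<psi> x - t'\<bar> \<le> 2 * (M * s)"
        using osc_support[OF _ s M] by (auto simp: cutoff_def split: if_splits)
      from cross[OF this(1) _ this(2,3)] show False using D True Ms s by simp
    qed
    then have "energy s M \<phi> t \<psi> t' = 0" unfolding energy_def by (simp only: integral_zero)
    then show ?thesis using s by simp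
  next
    case False
    then have sn0: "sin (\<phi> - \<psi>) \<noteq> 0" using D0 by auto
    have "(D / 10)\<^sup>2 \<le> \<bar>sin (\<phi> - \<psi>)\<bar>\<^sup>2" using False D0 by (intro power_mono) auto
    then have "(D / 10)\<^sup>2 \<le> (sin (\<phi> - \<psi>))\<^sup>2" by simp
    then have "96 * (real M * s) * s\<^sup>2 / (sin (\<phi> - \<psi>))\<^sup>2 \<le> 96 * (real M * s) * s\<^sup>2 / (D / 10)\<^sup>2"
      using s D0 by (intro divide_left_mono) (auto intro!: mult_pos_pos zero_less_power2[THEN iffD2] sn0)
    then show ?thesis using energy_transversal[OF s M sn0, of t t'] by (simp add: power2_eq_square)
  qed
qed

section \<open>Incidences of lines that satisfy a non-concentration bound\<close>

lemma geometric_sum_le: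
  fixes x :: real
  assumes "0 \<le> x" "x < 1"
  shows "(\<Sum>k\<le>K. x ^ k) \<le> 1 / (1 - x)"
proof -
  have "(1 - x) * (\<Sum>k\<le>K. x ^ k) = 1 - x ^ Suc K" by (rule sum_gp_basic)
  also have "\<dots> \<le> 1" using assms by simp
  finally show ?thesis using assms by (simp add: field_simps)
qed

lemma sum_of_bool_swap:
  fixes c :: "'k \<Rightarrow> real"
  assumes "finite J"
  shows "(\<Sum>j\<in>J. \<Sum>k\<in>K. c k * of_bool (P j k)) = (\<Sum>k\<in>K. c k * card {j \<in> J. P j k})"
proof -
  have "(\<Sum>j\<in>J. of_bool (P j k)) = real (card {j \<in> J. P j k})" for k
    using assms by (simp add: of_bool_def sum.If_cases Int_def)
  then show ?thesis by (subst sum.swap) (simp flip: sum_distrib_left)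
qed

text \<open>Dyadic shells below \<open>R\<close>: about \<open>A * w powr (1 + \<sigma>)\<close> terms of size \<open>1 / w\<close> in the shell at \<open>w\<close> add up to a geometric
  series dominated by the largest shell, since \<open>\<sigma> > 0\<close>.\<close>

lemma near_sum_le:
  fixes D :: "'a \<Rightarrow> real"
  assumes J: "finite J" and s: "0 < s" "\<And>j. j \<in> J \<Longrightarrow> s \<le> D j" and "0 < \<sigma>" "0 \<le> A" "0 < R"
    and cnt: "\<And>w. s \<le> w \<Longrightarrow> real (card {j \<in> J. D j \<le> w}) \<le> A * w powr (1 + \<sigma>)"
  shows "(\<Sum>j | j \<in> J \<and> D j \<le> R. 1 / D j) \<le> 2 * A * R powr \<sigma> / (1 - 2 powr (- \<sigma>))"
proof -
  have cnt': "real (card {j \<in> J. D j \<le> w}) \<le> A * w powr (1 + \<sigma>)" for w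
  proof (cases "s \<le> w")
    case False
    then have "{j \<in> J. D j \<le> w} = {}" using s by force
    then have "card {j \<in> J. D j \<le> w} = 0" by (simp only: card.empty)
    then show ?thesis using \<open>0 \<le> A\<close> by simp
  qed (rule cnt)
  obtain K where K: "(1/2::real) ^ K < s / R"
    using real_arch_pow_inv[of "s / R" "1/2"] s \<open>0 < R\<close> by auto
  \<comment> \<open>the term of the shell that contains \<open>D j\<close> alone suffices\<close>
  have pt: "1 / D j \<le> (\<Sum>k\<le>K. 2 ^ (k + 1) / R * of_bool (D j \<le> R / 2 ^ k))" if j: "j \<in> J" "D j \<le> R" for j
  proof -
    have Dj: "0 < D j" "s \<le> D j" using s j by force+
    have ex: "R / 2 ^ (K + 1) < D j"
    proof -
      have "R / 2 ^ K < s" using K \<open>0 < R\<close> by (simp add: field_simps)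
      moreover have "R / 2 ^ (K + 1) \<le> R / 2 ^ K" using \<open>0 < R\<close> by (simp add: field_simps)
      ultimately show ?thesis using Dj by linarith
    qed
    define k where "k = (LEAST k. R / 2 ^ (k + 1) < D j)"
    have k1: "R / 2 ^ (k + 1) < D j" unfolding k_def by (rule LeastI[of "\<lambda>k. R / 2 ^ (k + 1) < D j", OF ex])
    have kK: "k \<le> K" unfolding k_def by (rule Least_le[of "\<lambda>k. R / 2 ^ (k + 1) < D j", OF ex])
    have k2: "D j \<le> R / 2 ^ k"
    proof (cases k)
      case 0 then show ?thesis using j by simp
    next
      case (Suc k')
      then have "\<not> R / 2 ^ (k' + 1) < D j" using not_less_Least[of k' "\<lambda>k. R / 2 ^ (k + 1) < D j"] by (simp add: k_def)
      then show ?thesis using Suc by simp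
    qed
    have "1 / D j \<le> 2 ^ (k + 1) / R * of_bool (D j \<le> R / 2 ^ k)"
      using k1 k2 Dj \<open>0 < R\<close> by (simp add: field_simps)
    also have "\<dots> \<le> (\<Sum>k\<le>K. 2 ^ (k + 1) / R * of_bool (D j \<le> R / 2 ^ k))"
      using kK \<open>0 < R\<close> by (intro member_le_sum) auto
    finally show ?thesis .
  qed
  have "(\<Sum>j | j \<in> J \<and> D j \<le> R. 1 / D j)
      \<le> (\<Sum>j | j \<in> J \<and> D j \<le> R. \<Sum>k\<le>K. 2 ^ (k + 1) / R * of_bool (D j \<le> R / 2 ^ k))"
    using pt by (intro sum_mono) auto
  also have "\<dots> \<le> (\<Sum>j\<in>J. \<Sum>k\<le>K. 2 ^ (k + 1) / R * of_bool (D j \<le> R / 2 ^ k))"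
    using J \<open>0 < R\<close> by (intro sum_mono2) (auto intro!: sum_nonneg)
  also have "\<dots> = (\<Sum>k\<le>K. 2 ^ (k + 1) / R * card {j \<in> J. D j \<le> R / 2 ^ k})"
    by (rule sum_of_bool_swap[OF J])
  also have "\<dots> \<le> (\<Sum>k\<le>K. 2 * A * R powr \<sigma> * (2 powr (- \<sigma>)) ^ k)"
  proof (rule sum_mono)
    fix k
    have "2 ^ (k + 1) / R * card {j \<in> J. D j \<le> R / 2 ^ k} \<le> 2 ^ (k + 1) / R * (A * (R / 2 ^ k) powr (1 + \<sigma>))"
      using cnt'[of "R / 2 ^ k"] \<open>0 < R\<close> by (intro mult_left_mono) auto
    also have "(R / 2 ^ k) powr (1 + \<sigma>) = (R / 2 ^ k) * (R powr \<sigma> * (2 powr (- \<sigma>)) ^ k)"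
    proof -
      have "(R / 2 ^ k) powr \<sigma> = R powr \<sigma> * (2 powr (- \<sigma>)) ^ k"
      proof -
        have "(2 ^ k) powr \<sigma> = (2 powr \<sigma>) ^ k" by (simp add: powr_powr mult.commute flip: powr_realpow)
        then show ?thesis using \<open>0 < R\<close> by (simp add: powr_divide powr_minus power_inverse field_simps)
      qed
      then show ?thesis using \<open>0 < R\<close> by (simp add: powr_add)
    qed
    also have "2 ^ (k + 1) / R * (A * ((R / 2 ^ k) * (R powr \<sigma> * (2 powr (- \<sigma>)) ^ k))) = 2 * A * R powr \<sigma> * (2 powr (- \<sigma>)) ^ k"
      using \<open>0 < R\<close> by simp
    finally show "2 ^ (k + 1) / R * card {j \<in> J. D j \<le> R / 2 ^ k} \<le> 2 * A * R powr \<sigma> * (2 powr (- \<sigma>)) ^ k" .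
  qed
  also have "\<dots> = 2 * A * R powr \<sigma> * (\<Sum>k\<le>K. (2 powr (- \<sigma>)) ^ k)" by (simp add: sum_distrib_left)
  also have "\<dots> \<le> 2 * A * R powr \<sigma> * (1 / (1 - 2 powr (- \<sigma>)))"
    using \<open>0 < \<sigma>\<close> \<open>0 \<le> A\<close> powr_less_mono[of "- \<sigma>" 0 "2::real"]
    by (intro mult_left_mono geometric_sum_le) auto
  finally show ?thesis by simp
qed

text \<open>Dyadic shells above \<open>R\<close>: now the terms have size \<open>1 / w\<^sup>2\<close>, and since \<open>\<sigma> < 1\<close> the smallest shell dominates.\<close>

lemma far_sum_le:
  fixes D :: "'a \<Rightarrow> real"
  assumes J: "finite J" and s: "0 < s" "s \<le> R" and \<sigma>: "0 < \<sigma>" "\<sigma> < 1" and "0 \<le> A"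
    and cnt: "\<And>w. s \<le> w \<Longrightarrow> real (card {j \<in> J. D j \<le> w}) \<le> A * w powr (1 + \<sigma>)"
  shows "(\<Sum>j | j \<in> J \<and> \<not> D j \<le> R. 1 / (D j)\<^sup>2) \<le> 4 * A * R powr (\<sigma> - 1) / (1 - 2 powr (\<sigma> - 1))"
proof -
  have R: "0 < R" using s by simp
  obtain K where K: "\<And>j. j \<in> J \<Longrightarrow> D j \<le> 2 ^ (K + 1) * R"
  proof -
    obtain K :: nat where "Max (insert 0 (D ` J)) / R < 2 ^ K"
      using real_arch_pow[of 2] by auto
    then have "Max (insert 0 (D ` J)) < 2 ^ K * R" using R by (simp add: field_simps)
    moreover have "2 ^ K * R \<le> 2 ^ (K + 1) * R" using R by simp
    ultimately have "Max (insert 0 (D ` J)) \<le> 2 ^ (K + 1) * R" by linarith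
    moreover have "D j \<le> Max (insert 0 (D ` J))" if "j \<in> J" for j using that J by simp
    ultimately have "\<And>j. j \<in> J \<Longrightarrow> D j \<le> 2 ^ (K + 1) * R" by (meson order_trans)
    then show ?thesis using that by blast
  qed
  have pt: "1 / (D j)\<^sup>2 \<le> (\<Sum>k\<le>K. 1 / (2 ^ k * R)\<^sup>2 * of_bool (D j \<le> 2 ^ (k + 1) * R))"
    if j: "j \<in> J" "\<not> D j \<le> R" for j
  proof -
    have ex: "D j \<le> 2 ^ (K + 1) * R" using K j by simp
    define k where "k = (LEAST k. D j \<le> 2 ^ (k + 1) * R)"
    have k1: "D j \<le> 2 ^ (k + 1) * R" unfolding k_def by (rule LeastI[of "\<lambda>k. D j \<le> 2 ^ (k + 1) * R", OF ex])
    have kK: "k \<le> K" unfolding k_def by (rule Least_le[of "\<lambda>k. D j \<le> 2 ^ (k + 1) * R", OF ex])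
    have k2: "2 ^ k * R \<le> D j"
    proof (cases k)
      case 0 then show ?thesis using j by simp
    next
      case (Suc k')
      then have "\<not> D j \<le> 2 ^ (k' + 1) * R" using not_less_Least[of k' "\<lambda>k. D j \<le> 2 ^ (k + 1) * R"] by (simp add: k_def)
      then show ?thesis using Suc by simp
    qed
    have "(2 ^ k * R)\<^sup>2 \<le> (D j)\<^sup>2" using k2 R by (intro power_mono) auto
    then have "1 / (D j)\<^sup>2 \<le> 1 / (2 ^ k * R)\<^sup>2" using R j s by (intro divide_left_mono) auto
    also have "\<dots> = 1 / (2 ^ k * R)\<^sup>2 * of_bool (D j \<le> 2 ^ (k + 1) * R)" using k1 by simp
    also have "\<dots> \<le> (\<Sum>k\<le>K. 1 / (2 ^ k * R)\<^sup>2 * of_bool (D j \<le> 2 ^ (k + 1) * R))"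
      using kK by (intro member_le_sum) auto
    finally show ?thesis .
  qed
  have "(\<Sum>j | j \<in> J \<and> \<not> D j \<le> R. 1 / (D j)\<^sup>2)
      \<le> (\<Sum>j | j \<in> J \<and> \<not> D j \<le> R. \<Sum>k\<le>K. 1 / (2 ^ k * R)\<^sup>2 * of_bool (D j \<le> 2 ^ (k + 1) * R))"
    using pt by (intro sum_mono) auto
  also have "\<dots> \<le> (\<Sum>j\<in>J. \<Sum>k\<le>K. 1 / (2 ^ k * R)\<^sup>2 * of_bool (D j \<le> 2 ^ (k + 1) * R))"
    using J by (intro sum_mono2) (auto intro!: sum_nonneg)
  also have "\<dots> = (\<Sum>k\<le>K. 1 / (2 ^ k * R)\<^sup>2 * card {j \<in> J. D j \<le> 2 ^ (k + 1) * R})"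
    by (rule sum_of_bool_swap[OF J])
  also have "\<dots> \<le> (\<Sum>k\<le>K. 4 * A * R powr (\<sigma> - 1) * (2 powr (\<sigma> - 1)) ^ k)"
  proof (rule sum_mono)
    fix k
    define r where "r = 2 ^ k * R"
    have r: "0 < r" "R \<le> r" using R by (simp_all add: r_def)
    have "card {j \<in> J. D j \<le> 2 ^ (k + 1) * R} \<le> A * (2 * r) powr (1 + \<sigma>)"
      using cnt[of "2 * r"] s(2) r s(1) unfolding r_def by (simp add: mult.assoc)
    also have "\<dots> \<le> A * (4 * (r\<^sup>2 * r powr (\<sigma> - 1)))"
    proof (intro mult_left_mono)
      have "(2 * r) powr (1 + \<sigma>) = 2 powr (1 + \<sigma>) * r powr (2 + (\<sigma> - 1))"
        using r by (simp add: powr_mult)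
      also have "\<dots> = 2 powr (1 + \<sigma>) * (r\<^sup>2 * r powr (\<sigma> - 1))"
        using r by (simp only: powr_add) simp
      also have "\<dots> \<le> 2 powr 2 * (r\<^sup>2 * r powr (\<sigma> - 1))"
        using \<sigma> by (intro mult_right_mono powr_mono) auto
      finally show "(2 * r) powr (1 + \<sigma>) \<le> 4 * (r\<^sup>2 * r powr (\<sigma> - 1))" by simp
    qed (rule \<open>0 \<le> A\<close>)
    finally have "1 / r\<^sup>2 * card {j \<in> J. D j \<le> 2 ^ (k + 1) * R} \<le> 1 / r\<^sup>2 * (A * (4 * (r\<^sup>2 * r powr (\<sigma> - 1))))"
      by (intro mult_left_mono) auto
    also have "\<dots> = 4 * A * r powr (\<sigma> - 1)" using r by simp
    also have "r powr (\<sigma> - 1) = R powr (\<sigma> - 1) * (2 powr (\<sigma> - 1)) ^ k"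
    proof -
      have "(2 ^ k) powr (\<sigma> - 1) = (2 powr (\<sigma> - 1)) ^ k"
        by (simp add: powr_powr mult.commute flip: powr_realpow)
      then show ?thesis using R by (simp add: r_def powr_mult)
    qed
    finally show "1 / (2 ^ k * R)\<^sup>2 * card {j \<in> J. D j \<le> 2 ^ (k + 1) * R} \<le> 4 * A * R powr (\<sigma> - 1) * (2 powr (\<sigma> - 1)) ^ k"
      by (simp add: r_def mult.assoc)
  qed
  also have "\<dots> = 4 * A * R powr (\<sigma> - 1) * (\<Sum>k\<le>K. (2 powr (\<sigma> - 1)) ^ k)" by (simp add: sum_distrib_left)
  also have "\<dots> \<le> 4 * A * R powr (\<sigma> - 1) * (1 / (1 - 2 powr (\<sigma> - 1)))"
    using \<sigma> \<open>0 \<le> A\<close> powr_less_mono[of "\<sigma> - 1" 0 "2::real"] by (intro mult_left_mono geometric_sum_le) auto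
  finally show ?thesis by simp
qed

text \<open>The two geometric series over dyadic shells, with ratios \<open>2 powr (- \<sigma>)\<close> below the scale \<open>M * s\<close> and \<open>2 powr (\<sigma> - 1)\<close>
  above it.\<close>

definition energy_const :: "real \<Rightarrow> real" where
  "energy_const \<sigma> = 96768 / (1 - 2 powr (- \<sigma>)) + 38400 / (1 - 2 powr (\<sigma> - 1))"

text \<open>Line \<open>i\<close> is the level set \<open>t i\<close> of \<open>height (\<phi> i)\<close> and is recorded together with two points \<open>p i\<close>, \<open>q i\<close> on it, the
  images of the end points of a tube's axis. A line counts as lying in a slab when both points do; no slab
  of width \<open>w \<ge> s\<close> may contain more than \<open>A * w powr (1 + \<sigma>)\<close> of them.\<close>

definition frostman_lines ::
  "nat set \<Rightarrow> (nat \<Rightarrow> real^3) \<Rightarrow> (nat \<Rightarrow> real^3) \<Rightarrow> (nat \<Rightarrow> real) \<Rightarrow> (nat \<Rightarrow> real) \<Rightarrow> real \<Rightarrow> real \<Rightarrow> real \<Rightarrow> bool"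
where
  "frostman_lines I p q \<phi> t s A \<sigma> \<longleftrightarrow> finite I \<and>
     (\<forall>i\<in>I. norm (p i) \<le> 2 \<and> norm (q i) \<le> 2 \<and> \<bar>\<phi> i\<bar> \<le> 2 \<and> height (\<phi> i) (p i) = t i \<and> height (\<phi> i) (q i) = t i) \<and>
     (\<forall>\<psi> \<tau> w. s \<le> w \<longrightarrow>
        real (card {i \<in> I. \<bar>height \<psi> (p i) - \<tau>\<bar> \<le> w \<and> \<bar>height \<psi> (q i) - \<tau>\<bar> \<le> w}) \<le> A * w powr (1 + \<sigma>))"

text \<open>Fix line \<open>i\<close> and let \<open>D j\<close> be the width of the smallest slab about it that contains line \<open>j\<close>. The non-concentration
  bound counts the lines with \<open>D j \<le> w\<close>, so the near and far energy bounds sum over dyadic shells to the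
  contribution of the shell \<open>D j\<close> about \<open>M * s\<close>.\<close>

lemma energy_sum_le:
  assumes F: "frostman_lines I p q \<phi> t s A \<sigma>" and s: "0 < s" and M: "1 \<le> M"
    and \<sigma>: "0 < \<sigma>" "\<sigma> < 1" and A: "0 \<le> A" and i: "i \<in> I"
  shows "(\<Sum>j\<in>I. energy s M (\<phi> i) (t i) (\<phi> j) (t j)) \<le> energy_const \<sigma> * A * s\<^sup>2 * (real M * s) powr \<sigma>"
proof -
  define \<rho> where "\<rho> = real M * s"
  have \<rho>: "0 < \<rho>" "s \<le> \<rho>" using s M by (simp_all add: \<rho>_def)
  \<comment> \<open>the maximum with \<open>s\<close> accounts for the width of the strips and keeps \<open>D\<close> positive\<close>
  define D where "D j = max s (max \<bar>height (\<phi> i) (p j) - t i\<bar> \<bar>height (\<phi> i) (q j) - t i\<bar>)" for j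
  have I: "finite I" using F by (simp add: frostman_lines_def)
  have Ds: "s \<le> D j" for j by (simp add: D_def)
  have D0: "0 < D j" for j using Ds[of j] s by simp
  have cnt: "real (card {j \<in> I. D j \<le> w}) \<le> A * w powr (1 + \<sigma>)" if "s \<le> w" for w
  proof -
    have "{j \<in> I. D j \<le> w} = {j \<in> I. \<bar>height (\<phi> i) (p j) - t i\<bar> \<le> w \<and> \<bar>height (\<phi> i) (q j) - t i\<bar> \<le> w}"
      using that by (auto simp: D_def)
    then show ?thesis using F that by (simp add: frostman_lines_def)
  qed
  have cross: "D j \<le> 2 * w + 5 * \<bar>sin (\<phi> i - \<phi> j)\<bar>"
    if j: "j \<in> I" and x: "norm x \<le> 3" "s \<le> w" "\<bar>height (\<phi> i) x - t i\<bar> \<le> w" "\<bar>height (\<phi> j) x - t j\<bar> \<le> w" for j x w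
  proof -
    have b: "\<bar>height (\<phi> i) y - t i\<bar> \<le> 2 * w + 5 * \<bar>sin (\<phi> i - \<phi> j)\<bar>" if "norm y \<le> 2" "height (\<phi> j) y = t j" for y
    proof -
      have "norm (y - x) \<le> 5" using norm_triangle_ineq4[of y x] that x by linarith
      then have "\<bar>height (\<phi> i) y - height (\<phi> i) x\<bar> \<le> w + 5 * \<bar>sin (\<phi> i - \<phi> j)\<bar>"
        using x that by (intro height_near_crossing) (auto simp: abs_minus_commute)
      then show ?thesis using x by linarith
    qed
    have "\<bar>height (\<phi> i) (p j) - t i\<bar> \<le> 2 * w + 5 * \<bar>sin (\<phi> i - \<phi> j)\<bar>"
       "\<bar>height (\<phi> i) (q j) - t i\<bar> \<le> 2 * w + 5 * \<bar>sin (\<phi> i - \<phi> j)\<bar>"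
      using F j by (auto simp: frostman_lines_def intro!: b)
    moreover have "s \<le> 2 * w + 5 * \<bar>sin (\<phi> i - \<phi> j)\<bar>" using x s by simp
    ultimately show ?thesis by (simp add: D_def)
  qed
  let ?E = "\<lambda>j. energy s M (\<phi> i) (t i) (\<phi> j) (t j)"
  have near: "?E j \<le> 6048 * s\<^sup>2 * (1 / D j)" if "j \<in> I" "D j \<le> 8 * \<rho>" for j
    using energy_near[OF s M Ds[of j], of "\<phi> i" "t i" "\<phi> j" "t j"] cross[OF that(1)] that by (simp add: \<rho>_def)
  have far: "?E j \<le> 9600 * \<rho> * s\<^sup>2 * (1 / (D j)\<^sup>2)" if "j \<in> I" "\<not> D j \<le> 8 * \<rho>" for j
    using energy_far[OF s M, of "D j" "\<phi> i" "t i" "\<phi> j" "t j"] cross[OF that(1)] that by (simp add: \<rho>_def)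
  have "(\<Sum>j\<in>I. ?E j) = (\<Sum>j | j \<in> I \<and> D j \<le> 8 * \<rho>. ?E j) + (\<Sum>j | j \<in> I \<and> \<not> D j \<le> 8 * \<rho>. ?E j)"
    using I by (subst sum.union_disjoint[symmetric]) (auto intro: sum.cong)
  also have "\<dots> \<le> (\<Sum>j | j \<in> I \<and> D j \<le> 8 * \<rho>. 6048 * s\<^sup>2 * (1 / D j))
      + (\<Sum>j | j \<in> I \<and> \<not> D j \<le> 8 * \<rho>. 9600 * \<rho> * s\<^sup>2 * (1 / (D j)\<^sup>2))"
    using near far by (intro add_mono sum_mono) auto
  also have "\<dots> = 6048 * s\<^sup>2 * (\<Sum>j | j \<in> I \<and> D j \<le> 8 * \<rho>. 1 / D j)
      + 9600 * \<rho> * s\<^sup>2 * (\<Sum>j | j \<in> I \<and> \<not> D j \<le> 8 * \<rho>. 1 / (D j)\<^sup>2)"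
    by (simp add: sum_distrib_left)
  also have "\<dots> \<le> 6048 * s\<^sup>2 * (2 * A * (8 * \<rho>) powr \<sigma> / (1 - 2 powr (- \<sigma>)))
      + 9600 * \<rho> * s\<^sup>2 * (4 * A * (8 * \<rho>) powr (\<sigma> - 1) / (1 - 2 powr (\<sigma> - 1)))"
    using \<rho> s \<sigma> A Ds cnt by (intro add_mono mult_left_mono near_sum_le[OF I] far_sum_le[OF I]) auto
  also have "\<dots> \<le> 6048 * s\<^sup>2 * (2 * A * (8 * \<rho> powr \<sigma>) / (1 - 2 powr (- \<sigma>)))
      + 9600 * \<rho> * s\<^sup>2 * (4 * A * \<rho> powr (\<sigma> - 1) / (1 - 2 powr (\<sigma> - 1)))"
  proof -
    have "(8::real) powr \<sigma> \<le> 8 powr 1" using \<sigma> by (intro powr_mono) auto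
    then have 1: "(8 * \<rho>) powr \<sigma> \<le> 8 * \<rho> powr \<sigma>" using \<rho> by (simp add: powr_mult)
    have "(8::real) powr (\<sigma> - 1) \<le> 8 powr 0" using \<sigma> by (intro powr_mono) auto
    then have 2: "(8 * \<rho>) powr (\<sigma> - 1) \<le> \<rho> powr (\<sigma> - 1)" using \<rho> by (simp add: powr_mult)
    have "2 powr (- \<sigma>) \<le> (2::real) powr 0" "2 powr (\<sigma> - 1) \<le> (2::real) powr 0" using \<sigma> by (intro powr_mono; simp)+
    then show ?thesis using 1 2 \<rho> A by (intro add_mono mult_left_mono divide_right_mono) auto
  qed
  also have "\<dots> = 96768 / (1 - 2 powr (- \<sigma>)) * A * s\<^sup>2 * \<rho> powr \<sigma> + 38400 / (1 - 2 powr (\<sigma> - 1)) * A * s\<^sup>2 * (\<rho> * \<rho> powr (\<sigma> - 1))"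
    by (simp add: mult_ac)
  also have "\<rho> * \<rho> powr (\<sigma> - 1) = \<rho> powr \<sigma>" using \<rho> by (simp add: powr_diff)
  finally show ?thesis by (simp add: energy_const_def \<rho>_def algebra_simps)
qed

text \<open>The lines within distance \<open>\<rho> = M * s\<close> of a point fall into \<open>O(1 / \<rho>)\<close> slabs of width \<open>O(\<rho>)\<close> through that point, one
  for each direction of a \<open>\<rho>\<close>-net of angles. Each slab contains at most about \<open>A * \<rho> powr (1 + \<sigma>)\<close> lines.\<close>

lemma wide_sum_le:
  assumes F: "frostman_lines I p q \<phi> t s A \<sigma>" and s: "0 < s" and M: "1 \<le> M"
    and \<sigma>: "0 < \<sigma>" "\<sigma> \<le> 1" and A: "0 \<le> A" and M1: "real M * s \<le> 1" and x: "norm x \<le> 2"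
  shows "(\<Sum>i\<in>I. wide s M (height (\<phi> i) x - t i)) \<le> 216 * A * s * (real M * s) powr (\<sigma> - 1)"
proof -
  define \<rho> where "\<rho> = real M * s"
  have \<rho>: "0 < \<rho>" "s \<le> \<rho>" "\<rho> \<le> 1" using s M M1 by (simp_all add: \<rho>_def)
  have I: "finite I" using F by (simp add: frostman_lines_def)
  define J where "J = {i \<in> I. \<bar>height (\<phi> i) x - t i\<bar> \<le> 2 * \<rho>}"
  define Z where "Z m = {i \<in> I. \<bar>height (of_int m * \<rho>) (p i) - height (of_int m * \<rho>) x\<bar> \<le> 6 * \<rho> \<and>
       \<bar>height (of_int m * \<rho>) (q i) - height (of_int m * \<rho>) x\<bar> \<le> 6 * \<rho>}" for m :: int
  define N where "N = {\<lfloor>- 2 / \<rho>\<rfloor>..\<lfloor>2 / \<rho>\<rfloor>}"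
  have JZ: "J \<subseteq> (\<Union>m\<in>N. Z m)"
  proof
    fix i assume i: "i \<in> J"
    define m where "m = \<lfloor>\<phi> i / \<rho>\<rfloor>"
    have "\<bar>\<phi> i\<bar> \<le> 2" using i F by (auto simp: J_def frostman_lines_def)
    then have "- 2 \<le> \<phi> i" "\<phi> i \<le> 2" by auto
    then have "- 2 / \<rho> \<le> \<phi> i / \<rho>" "\<phi> i / \<rho> \<le> 2 / \<rho>" using \<rho> by (intro divide_right_mono; simp)+
    then have mN: "m \<in> N" by (auto simp: m_def N_def intro: floor_mono)
    have "of_int m \<le> \<phi> i / \<rho>" "\<phi> i / \<rho> < of_int m + 1" by (auto simp: m_def)
    then have "of_int m * \<rho> \<le> \<phi> i" "\<phi> i < of_int m * \<rho> + \<rho>" using \<rho> by (auto simp: field_simps)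
    then have "\<bar>of_int m * \<rho> - \<phi> i\<bar> \<le> \<rho>" by simp
    moreover have "\<bar>sin (of_int m * \<rho> - \<phi> i)\<bar> \<le> \<bar>of_int m * \<rho> - \<phi> i\<bar>" by (rule abs_sin_x_le_abs_x)
    ultimately have sn: "\<bar>sin (of_int m * \<rho> - \<phi> i)\<bar> \<le> \<rho>" by linarith
    have b: "\<bar>height (of_int m * \<rho>) y - height (of_int m * \<rho>) x\<bar> \<le> 6 * \<rho>" if "norm y \<le> 2" "height (\<phi> i) y = t i" for y
    proof -
      have "norm (y - x) \<le> 4" using norm_triangle_ineq4[of y x] that x by linarith
      then have "\<bar>height (of_int m * \<rho>) y - height (of_int m * \<rho>) x\<bar> \<le> 2 * \<rho> + 4 * \<bar>sin (of_int m * \<rho> - \<phi> i)\<bar>"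
        using i that by (intro height_near_crossing) (auto simp: J_def abs_minus_commute)
      then show ?thesis using sn by linarith
    qed
    have "i \<in> Z m" using i F by (auto simp: J_def Z_def frostman_lines_def intro!: b)
    then show "i \<in> (\<Union>m\<in>N. Z m)" using mN by blast
  qed
  have cZ: "card (Z m) \<le> A * (36 * \<rho> powr (1 + \<sigma>))" for m
  proof -
    have "card (Z m) \<le> A * (6 * \<rho>) powr (1 + \<sigma>)"
      using F \<rho> by (auto simp: Z_def frostman_lines_def)
    also have "\<dots> \<le> A * (6 powr 2 * \<rho> powr (1 + \<sigma>))"
    proof (intro mult_left_mono)
      have "(6::real) powr (1 + \<sigma>) \<le> 6 powr 2" using \<sigma> by (intro powr_mono) auto
      then show "(6 * \<rho>) powr (1 + \<sigma>) \<le> 6 powr 2 * \<rho> powr (1 + \<sigma>)"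
        using \<rho> by (simp add: powr_mult del: powr_numeral)
    qed (rule A)
    finally show ?thesis by simp
  qed
  have cN: "real (card N) \<le> 6 / \<rho>"
  proof -
    have n0: "-1 \<le> (2 / \<rho>)" using \<rho> by (smt (verit) divide_pos_pos)
    have "\<lfloor>- 2 / \<rho>\<rfloor> \<le> \<lfloor>2 / \<rho>\<rfloor>" using \<rho> by (intro floor_mono divide_right_mono) auto
    then have "real (card N) = of_int (\<lfloor>2 / \<rho>\<rfloor> - \<lfloor>- 2 / \<rho>\<rfloor> + 1)" by (simp add: N_def)
    also have "\<dots> \<le> 2 / \<rho> - (- 2 / \<rho> - 1) + 1"
    proof -
      have "of_int \<lfloor>2 / \<rho>\<rfloor> \<le> 2 / \<rho>" "- 2 / \<rho> - 1 \<le> of_int \<lfloor>- 2 / \<rho>\<rfloor>" by linarith+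
      then show ?thesis unfolding of_int_add of_int_diff of_int_1 by linarith
    qed
    also have "\<dots> = 4 / \<rho> + 2" by simp
    also have "\<dots> \<le> 6 / \<rho>" using \<rho> by (simp add: field_simps)
    finally show ?thesis .
  qed
  have finZ: "finite (Z m)" for m using I by (simp add: Z_def)
  have "card J \<le> card (\<Union>m\<in>N. Z m)" using JZ finZ by (intro card_mono) (auto simp: N_def)
  also have "\<dots> \<le> (\<Sum>m\<in>N. card (Z m))" by (rule card_UN_le) (simp add: N_def)
  finally have "real (card J) \<le> (\<Sum>m\<in>N. real (card (Z m)))" by (metis of_nat_mono of_nat_sum)
  also have "\<dots> \<le> (\<Sum>m\<in>N. A * (36 * \<rho> powr (1 + \<sigma>)))" by (intro sum_mono cZ)
  also have "\<dots> = card N * (A * (36 * \<rho> powr (1 + \<sigma>)))" by simp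
  also have "\<dots> \<le> 6 / \<rho> * (A * (36 * \<rho> powr (1 + \<sigma>)))" using cN A by (intro mult_right_mono) auto
  also have "\<dots> = 216 * A * \<rho> powr \<sigma>" using \<rho> by (simp add: powr_add)
  finally have cJ: "real (card J) \<le> 216 * A * \<rho> powr \<sigma>" .
  have "(\<Sum>i\<in>I. wide s M (height (\<phi> i) x - t i)) = (\<Sum>i\<in>J. wide s M (height (\<phi> i) x - t i))"
  proof (rule sum.mono_neutral_right[OF I])
    show "J \<subseteq> I" by (auto simp: J_def)
    show "\<forall>i\<in>I - J. wide s M (height (\<phi> i) x - t i) = 0"
    proof
      fix i assume "i \<in> I - J"
      then have "2 * \<rho> < \<bar>height (\<phi> i) x - t i\<bar>" by (auto simp: J_def)
      moreover have "(2 * real M - 1) * s = 2 * \<rho> - s" by (simp add: \<rho>_def algebra_simps)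
      ultimately show "wide s M (height (\<phi> i) x - t i) = 0"
        using \<rho> s by (auto simp: wide_def indicator_def)
    qed
  qed
  also have "\<dots> \<le> (\<Sum>i\<in>J. 1 / M)" by (intro sum_mono wide_bounds)
  also have "\<dots> = card J * (1 / M)" by simp
  also have "\<dots> \<le> 216 * A * \<rho> powr \<sigma> * (1 / M)" using cJ by (intro mult_right_mono) auto
  also have "\<dots> = 216 * A * s * \<rho> powr (\<sigma> - 1)"
    using \<rho> M s by (simp add: \<rho>_def powr_diff field_simps)
  finally show ?thesis by (simp add: \<rho>_def)
qed

text \<open>With \<open>f\<close>, \<open>g\<close> and \<open>h = f - g\<close> the sums of the strips, of their coarse averages and of the oscillations, completing
  the square gives \<open>f \<le> g + \<beta> + h\<^sup>2 / (4 * \<beta>)\<close> pointwise. Integrated over \<open>W\<close>, the first two terms are controlled by the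
  pointwise bound on \<open>g\<close> and the last by the energy bound. For \<open>M = 1\<close> there is no oscillation, which is what covers
  \<open>\<sigma> = 1\<close>, where the far sum diverges.\<close>

lemma incidence_mass_one_scale:
  assumes F: "frostman_lines I p q \<phi> t s A \<sigma>" and s: "0 < s" and M: "1 \<le> M"
    and \<sigma>: "0 < \<sigma>" "\<sigma> \<le> 1" "M = 1 \<or> \<sigma> < 1" and A: "0 < A" and M1: "real M * s \<le> 1"
    and W: "W \<in> sets borel" "W \<subseteq> cball 0 2"
  shows "(\<Sum>i\<in>I. measure lborel (W \<inter> {x. -s \<le> height (\<phi> i) x - t i \<and> height (\<phi> i) x - t i < s}))
    \<le> 217 * A * s * (real M * s) powr (\<sigma> - 1) * measure lborel W
      + (if M = 1 then 0 else energy_const \<sigma> / 4 * card I * s * (real M * s))"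
proof -
  define \<rho> where "\<rho> = real M * s"
  have \<rho>: "0 < \<rho>" "s \<le> \<rho>" "\<rho> \<le> 1" using s M M1 by (simp_all add: \<rho>_def)
  \<comment> \<open>of the size of the pointwise bound for \<open>g\<close>, so that adding it to that bound costs nothing\<close>
  define \<beta> where "\<beta> = A * s * \<rho> powr (\<sigma> - 1)"
  have \<beta>: "0 < \<beta>" using A s \<rho> by (simp add: \<beta>_def)
  have I: "finite I" using F by (simp add: frostman_lines_def)
  define h where "h x = (\<Sum>i\<in>I. osc s M (height (\<phi> i) x - t i))" for x
  have [measurable]: "h \<in> borel_measurable borel" "W \<in> sets borel" unfolding h_def[abs_def] using W by measurable
  have finW: "emeasure lborel W < \<infinity>"
    by (rule le_less_trans[OF emeasure_mono[OF W(2)] emeasure_lborel_cball_finite]) simp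
  have hb: "\<bar>h x * h x\<bar> \<le> real (card I) * real (card I)" for x
  proof -
    have "\<bar>h x\<bar> \<le> (\<Sum>i\<in>I. 1)" unfolding h_def
      using abs_osc_le_1[OF M] by (intro order_trans[OF sum_abs] sum_mono)
    then show ?thesis unfolding abs_mult by (intro mult_mono) auto
  qed
  have inth: "integrable lborel (\<lambda>x. cutoff x * (h x * h x))" by (rule integrable_cutoff[OF _ hb]) measurable
  have "(\<integral>x. cutoff x * (h x * h x) \<partial>lborel) = (\<Sum>i\<in>I. \<Sum>j\<in>I. energy s M (\<phi> i) (t i) (\<phi> j) (t j))"
  proof -
    have "integrable lborel (\<lambda>x. cutoff x * (osc s M (height (\<phi> i) x - t i) * osc s M (height (\<phi> j) x - t j)))" for i j
      by (rule integrable_cutoff[where B = 1])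
         (use abs_osc_le_1[OF M] in \<open>auto simp: abs_mult intro!: mult_le_one\<close>)
    moreover have "cutoff x * (h x * h x) = (\<Sum>i\<in>I. \<Sum>j\<in>I.
        cutoff x * (osc s M (height (\<phi> i) x - t i) * osc s M (height (\<phi> j) x - t j)))" for x
      unfolding h_def sum_product by (simp add: sum_distrib_left)
    ultimately show ?thesis unfolding energy_def by simp
  qed
  also have "\<dots> \<le> (if M = 1 then 0 else (\<Sum>i\<in>I. energy_const \<sigma> * A * s\<^sup>2 * \<rho> powr \<sigma>))"
  proof (cases "M = 1")
    case True
    then show ?thesis by (simp add: energy_def osc_def wide_1[unfolded One_nat_def])
  next
    case False
    then have "(\<Sum>i\<in>I. \<Sum>j\<in>I. energy s M (\<phi> i) (t i) (\<phi> j) (t j)) \<le> (\<Sum>i\<in>I. energy_const \<sigma> * A * s\<^sup>2 * \<rho> powr \<sigma>)"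
      using energy_sum_le[OF F s M] \<sigma> A unfolding \<rho>_def by (intro sum_mono) auto
    then show ?thesis using False by simp
  qed
  also have "\<dots> = (if M = 1 then 0 else card I * (energy_const \<sigma> * A * s\<^sup>2 * \<rho> powr \<sigma>))" by simp
  finally have E: "(\<integral>x. cutoff x * (h x * h x) \<partial>lborel) \<le> (if M = 1 then 0 else card I * (energy_const \<sigma> * A * s\<^sup>2 * \<rho> powr \<sigma>))" .
  let ?f = "\<lambda>x. \<Sum>i\<in>I. strip s (height (\<phi> i) x - t i)"
  let ?S = "\<lambda>i. {x. -s \<le> height (\<phi> i) x - t i \<and> height (\<phi> i) x - t i < s}"
  have mS: "?S i \<in> sets borel" for i by measurable
  have finS: "emeasure lborel (W \<inter> ?S i) < \<infinity>" for i
    by (rule le_less_trans[OF emeasure_mono finW]) auto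
  have pt: "indicator W x * ?f x \<le> 217 * \<beta> * indicator W x + cutoff x * (h x * h x) / (4 * \<beta>)" for x
  proof (cases "x \<in> W")
    case True
    then have nx: "norm x \<le> 2" using W by auto
    then have c1: "1 \<le> cutoff x" by (simp add: cutoff_def)
    have "?f x = (\<Sum>i\<in>I. wide s M (height (\<phi> i) x - t i)) + h x"
      by (simp add: h_def osc_def flip: sum.distrib)
    also have "\<dots> \<le> 216 * \<beta> + h x"
      using wide_sum_le[OF F s M \<sigma>(1,2) _ M1 nx] A by (simp add: \<beta>_def \<rho>_def)
    also have "h x \<le> \<beta> + h x * h x / (4 * \<beta>)"
    proof -
      have "0 \<le> (h x - 2 * \<beta>)\<^sup>2" by simp
      then have "4 * \<beta> * h x \<le> 4 * \<beta> * \<beta> + h x * h x" by (simp add: power2_eq_square algebra_simps)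
      then show ?thesis using \<beta> by (simp add: field_simps)
    qed
    also have "h x * h x / (4 * \<beta>) \<le> cutoff x * (h x * h x) / (4 * \<beta>)"
      using c1 \<beta> mult_right_mono[OF c1, of "h x * h x"] by (intro divide_right_mono) auto
    finally show ?thesis using True by simp
  next
    case False
    then show ?thesis using \<beta> cutoff_bounds(1)[of x] by simp
  qed
  have WS: "indicator W x * ?f x = (\<Sum>i\<in>I. indicat_real (W \<inter> ?S i) x)" for x
    by (auto simp: sum_distrib_left strip_def indicator_def intro!: sum.cong)
  have "(\<Sum>i\<in>I. measure lborel (W \<inter> ?S i)) = (\<integral>x. (\<Sum>i\<in>I. indicat_real (W \<inter> ?S i) x) \<partial>lborel)"
    using finS mS by (subst Bochner_Integration.integral_sum) auto
  also have "\<dots> \<le> (\<integral>x. 217 * \<beta> * indicator W x + cutoff x * (h x * h x) / (4 * \<beta>) \<partial>lborel)"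
  proof (rule integral_mono)
    show "integrable lborel (\<lambda>x. \<Sum>i\<in>I. indicat_real (W \<inter> ?S i) x)"
      using finS mS by auto
    show "integrable lborel (\<lambda>x. 217 * \<beta> * indicator W x + cutoff x * (h x * h x) / (4 * \<beta>))"
      using inth finW by auto
  qed (use pt WS in simp)
  also have "\<dots> = 217 * \<beta> * measure lborel W + (\<integral>x. cutoff x * (h x * h x) \<partial>lborel) / (4 * \<beta>)"
    using inth finW by simp
  also have "\<dots> \<le> 217 * \<beta> * measure lborel W + (if M = 1 then 0 else card I * (energy_const \<sigma> * A * s\<^sup>2 * \<rho> powr \<sigma>)) / (4 * \<beta>)"
    using E \<beta> by (intro add_left_mono divide_right_mono) auto
  also have "(if M = 1 then 0 else card I * (energy_const \<sigma> * A * s\<^sup>2 * \<rho> powr \<sigma>)) / (4 * \<beta>)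
    = (if M = 1 then 0 else energy_const \<sigma> / 4 * card I * s * \<rho>)"
    using \<rho> s A by (simp add: \<beta>_def powr_diff field_simps power2_eq_square)
  finally show ?thesis by (simp only: \<beta>_def \<rho>_def mult.assoc)
qed

definition incidence_const :: "real \<Rightarrow> real" where
  "incidence_const \<sigma> = 434 + \<bar>energy_const \<sigma>\<bar>"

text \<open>With \<open>V = \<Lambda> |W|\<close>, the bound at scale \<open>\<rho>\<close> reads \<open>V * \<rho> powr (\<sigma> - 1) + \<rho>\<close> up to the factor \<open>card I * s\<close>. The two terms
  agree for \<open>\<rho> = V powr (1 / (2 - \<sigma>))\<close>, and this is where the exponent \<open>2 - \<sigma>\<close> comes from. If that scale is finer than
  \<open>s\<close>, the choice \<open>\<rho> = s\<close> is already good enough.\<close>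

lemma incidence_mass:
  fixes \<Lambda> :: real
  assumes F: "frostman_lines I p q \<phi> t s (\<Lambda> * card I) \<sigma>" and s: "0 < s" "s \<le> 1" and N: "1 \<le> card I"
    and \<sigma>: "0 < \<sigma>" "\<sigma> \<le> 1" and \<Lambda>: "0 < \<Lambda>"
    and W: "W \<in> sets borel" "W \<subseteq> cball 0 2" and V: "\<Lambda> * measure lborel W \<le> 1"
  shows "(\<Sum>i\<in>I. measure lborel (W \<inter> {x. -s \<le> height (\<phi> i) x - t i \<and> height (\<phi> i) x - t i < s}))
    \<le> incidence_const \<sigma> * card I * s * (\<Lambda> * measure lborel W) powr (1 / (2 - \<sigma>))" (is "?S \<le> _")
proof -
  define V where "V = \<Lambda> * measure lborel W"
  define v where "v = V powr (1 / (2 - \<sigma>))"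
  define n where "n = real (card I)"
  have n: "0 < n" using N by (simp add: n_def)
  have V0: "0 \<le> V" "V \<le> 1" using \<Lambda> assms(10) by (auto simp: V_def)
  have v0: "0 \<le> v" "v \<le> 1" using V0 \<sigma> by (auto simp: v_def powr_le_one_le powr_le1)
  have Vv: "V = v * v powr (1 - \<sigma>)"
  proof (cases "V = 0")
    case False
    then have "0 < v" using V0 by (simp add: v_def)
    have "v * v powr (1 - \<sigma>) = v powr (1 + (1 - \<sigma>))" using \<open>0 < v\<close> by (simp only: powr_add) simp
    also have "\<dots> = V powr ((2 - \<sigma>) / (2 - \<sigma>))" by (simp add: v_def powr_powr)
    finally show ?thesis using V0 False \<sigma> by simp
  qed (simp add: v_def)
  have A: "0 < \<Lambda> * card I" using \<Lambda> N by simp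
  have AW: "\<Lambda> * card I * measure lborel W = n * V" by (simp add: V_def n_def)
  show ?thesis
  proof (cases "\<sigma> = 1 \<or> v \<le> s")
    case True
    have "?S \<le> 217 * (\<Lambda> * card I) * s * s powr (\<sigma> - 1) * measure lborel W"
      using incidence_mass_one_scale[OF F s(1) _ \<sigma> _ A _ W, of 1] s by simp
    also have "\<dots> = 217 * n * s * (V * s powr (\<sigma> - 1))" using AW by (simp add: algebra_simps)
    also have "V * s powr (\<sigma> - 1) \<le> v"
    proof -
      have "v powr (1 - \<sigma>) \<le> s powr (1 - \<sigma>) \<or> \<sigma> = 1"
        using True v0 \<sigma> by (auto intro: powr_mono2)
      then have "v powr (1 - \<sigma>) * s powr (\<sigma> - 1) \<le> s powr (1 - \<sigma>) * s powr (\<sigma> - 1)"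
        using s v0 by (auto intro!: mult_right_mono)
      also have "\<dots> = 1" using s by (simp flip: powr_add)
      finally show ?thesis unfolding Vv mult.assoc using v0 by (intro mult_left_le) auto
    qed
    also have "217 * n * s * v \<le> incidence_const \<sigma> * n * s * v"
      using n s v0 by (intro mult_right_mono) (auto simp: incidence_const_def)
    finally show ?thesis using n s by (simp add: v_def V_def n_def)
  next
    case False
    then have \<sigma>1: "\<sigma> < 1" and vs: "s < v" using \<sigma> by auto
    \<comment> \<open>the largest multiple of \<open>s\<close> below the balanced scale \<open>v\<close>, hence at least \<open>v / 2\<close>\<close>
    define M where "M = nat \<lfloor>v / s\<rfloor>"
    have fl: "1 \<le> \<lfloor>v / s\<rfloor>" using vs s by (simp add: le_floor_iff)
    have M1: "1 \<le> M" using fl by (simp add: M_def le_nat_iff)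
    have rM: "real M = of_int \<lfloor>v / s\<rfloor>" using fl by (simp add: M_def)
    have "real M \<le> v / s" "v / s < real M + 1" unfolding rM by linarith+
    then have Mv: "real M * s \<le> v" "v < real M * s + s" using s by (auto simp: field_simps)
    have Ms: "s \<le> real M * s" using M1 s by simp
    then have v2: "v / 2 \<le> real M * s" using Mv by linarith
    have "?S \<le> 217 * (\<Lambda> * card I) * s * (real M * s) powr (\<sigma> - 1) * measure lborel W
      + (if M = 1 then 0 else energy_const \<sigma> / 4 * card I * s * (real M * s))"
      using incidence_mass_one_scale[OF F s(1) M1 \<sigma> _ A _ W] \<sigma>1 Mv v0 by simp
    also have "\<dots> \<le> 217 * (\<Lambda> * card I) * s * (real M * s) powr (\<sigma> - 1) * measure lborel W
      + \<bar>energy_const \<sigma>\<bar> * n * s * v"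
    proof (intro add_left_mono)
      have "energy_const \<sigma> / 4 * card I * s * (real M * s) \<le> \<bar>energy_const \<sigma>\<bar> * n * s * v"
        using n s Mv v0 unfolding n_def by (intro mult_mono) auto
      then show "(if M = 1 then 0 else energy_const \<sigma> / 4 * card I * s * (real M * s)) \<le> \<bar>energy_const \<sigma>\<bar> * n * s * v"
        using n s v0 by auto
    qed
    also have "217 * (\<Lambda> * card I) * s * (real M * s) powr (\<sigma> - 1) * measure lborel W
       = 217 * n * s * (V * (real M * s) powr (\<sigma> - 1))" using AW by (simp add: algebra_simps)
    also have "V * (real M * s) powr (\<sigma> - 1) \<le> 2 * v"
    proof -
      have "(real M * s) powr (\<sigma> - 1) \<le> (v / 2) powr (\<sigma> - 1)"
        using v2 vs s \<sigma>1 by (intro powr_mono2') auto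
      also have "\<dots> = v powr (\<sigma> - 1) * 2 powr (1 - \<sigma>)"
        using vs s by (simp add: powr_divide powr_diff field_simps)
      also have "\<dots> \<le> v powr (\<sigma> - 1) * 2 powr 1" using \<sigma> by (intro mult_left_mono powr_mono) auto
      finally have "V * (real M * s) powr (\<sigma> - 1) \<le> V * (v powr (\<sigma> - 1) * 2)"
        using V0 by (intro mult_left_mono) auto
      also have "\<dots> = 2 * v * (v powr (1 - \<sigma>) * v powr (\<sigma> - 1))" by (subst Vv) simp
      also have "v powr (1 - \<sigma>) * v powr (\<sigma> - 1) = 1" using vs s by (simp flip: powr_add)
      finally show ?thesis by simp
    qed
    finally have "?S \<le> 217 * n * s * (2 * v) + \<bar>energy_const \<sigma>\<bar> * n * s * v" using n s by simp
    also have "\<dots> = incidence_const \<sigma> * n * s * v" by (simp add: incidence_const_def algebra_simps)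
    finally show ?thesis by (simp add: v_def V_def n_def)
  qed
qed

section \<open>Volumes of tubes and of thickened shadings\<close>

lemma lmeasurable_borel_bounded:
  fixes S :: "(real^3) set"
  assumes "S \<in> sets borel" "bounded S"
  shows "S \<in> lmeasurable"
proof (rule bounded_set_imp_lmeasurable[OF assms(2)])
  show "S \<in> sets lebesgue" using assms(1) by (simp add: sets_completionI_sets)
qed

lemma measure_isometry:
  fixes S :: "(real^3) set" and f :: "real^3 \<Rightarrow> real^3"
  assumes "orthogonal_transformation f" "S \<in> lmeasurable"
  shows "measure lebesgue ((\<lambda>x. p + f x) ` S) = measure lebesgue S" "(\<lambda>x. p + f x) ` S \<in> lmeasurable"
proof -
  have e: "(\<lambda>x. p + f x) ` S = (+) p ` (f ` S)" by (simp add: image_image)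
  show "measure lebesgue ((\<lambda>x. p + f x) ` S) = measure lebesgue S"
    unfolding e using measure_translation[of p "f ` S"] measure_orthogonal_image[OF assms] by simp
  show "(\<lambda>x. p + f x) ` S \<in> lmeasurable"
    unfolding e by (intro measurable_translation measurable_orthogonal_image assms)
qed

lemma infdist_segment_attained:
  fixes P Q :: "real^3"
  assumes "infdist x (closed_segment P Q) \<le> \<rho>"
  shows "\<exists>y\<in>closed_segment P Q. dist x y \<le> \<rho>"
proof -
  obtain y where "y \<in> closed_segment P Q" "infdist x (closed_segment P Q) = dist x y"
    using infdist_attains_inf[of "closed_segment P Q" x] by auto
  with assms show ?thesis by auto
qed

lemma closed_infdist_le: "closed {x::real^3. infdist x A \<le> \<rho>}"
  by (intro closed_Collect_le continuous_intros)

lemma bounded_segment_nbhd: "bounded {x::real^3. infdist x (closed_segment P Q) \<le> \<rho>}"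
proof -
  obtain R where R: "\<And>y. y \<in> closed_segment P Q \<Longrightarrow> norm y \<le> R"
    using bounded_closed_segment[of P Q] by (auto simp: bounded_iff)
  show ?thesis
  proof (rule boundedI)
    fix x assume "x \<in> {x. infdist x (closed_segment P Q) \<le> \<rho>}"
    then obtain y where "y \<in> closed_segment P Q" "dist x y \<le> \<rho>" using infdist_segment_attained by blast
    then show "norm x \<le> R + \<rho>" using R[of y] norm_triangle_ineq2[of x y] by (auto simp: dist_norm)
  qed
qed

text \<open>A rotation takes the axis to the third coordinate direction and the piece of tube into a box with sides
  \<open>2 * \<rho>\<close>, \<open>2 * \<rho>\<close> and \<open>2 * a\<close>.\<close>

lemma segment_nbhd_ball_measure:
  fixes P Q z :: "real^3"
  assumes PQ: "P \<noteq> Q" and \<rho>: "0 \<le> \<rho>" and a: "0 < a"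
  defines "S \<equiv> {x::real^3. infdist x (closed_segment P Q) \<le> \<rho>} \<inter> ball z a"
  shows "S \<in> sets borel" "S \<in> lmeasurable" "measure lebesgue S \<le> 8 * \<rho>\<^sup>2 * a"
proof -
  show Sb: "S \<in> sets borel" unfolding S_def
    by (rule sets.Int[OF borel_closed[OF closed_infdist_le] borel_open[OF open_ball]])
  show Sm: "S \<in> lmeasurable"
    by (rule lmeasurable_borel_bounded[OF Sb]) (auto simp: S_def intro: bounded_subset[OF bounded_ball])
  define e where "e = (1 / norm (Q - P)) *\<^sub>R (Q - P)"
  have "norm e = 1" using PQ by (simp add: e_def)
  then obtain f where f: "orthogonal_transformation f" "f e = (axis 3 1 :: real^3)"
    using orthogonal_transformation_exists_1[of e "axis 3 1 :: real^3"] norm_axis_1 by metis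
  have lin: "linear f" using f by (simp add: orthogonal_transformation_linear)
  define g where "g x = - f P + f x" for x
  have gd: "g x = f (x - P)" for x by (simp add: g_def linear_diff[OF lin])
  define c where "c = g z $ 3"
  have "g ` S \<subseteq> cbox (vector [-\<rho>, -\<rho>, c - a]) (vector [\<rho>, \<rho>, c + a])"
  proof (rule image_subsetI)
    fix x assume x: "x \<in> S"
    then obtain y where y: "y \<in> closed_segment P Q" "dist x y \<le> \<rho>"
      unfolding S_def using infdist_segment_attained by blast
    then obtain u where u: "y = (1 - u) *\<^sub>R P + u *\<^sub>R Q" by (auto simp: in_segment)
    have "y - P = (u * norm (Q - P)) *\<^sub>R e" using PQ u by (simp add: e_def algebra_simps)
    then have fy: "f (y - P) = (u * norm (Q - P)) *\<^sub>R axis 3 1" by (simp add: linear_scale[OF lin] f)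
    have "g x = f (x - y) + f (y - P)" unfolding gd using linear_add[OF lin, of "x - y" "y - P"] by simp
    then have c12: "g x $ 1 = f (x - y) $ 1" "g x $ 2 = f (x - y) $ 2" by (simp_all add: fy axis_def)
    have "norm (f (x - y)) \<le> \<rho>" using y f by (simp add: orthogonal_transformation_norm dist_norm)
    then have 1: "\<bar>g x $ 1\<bar> \<le> \<rho>" "\<bar>g x $ 2\<bar> \<le> \<rho>"
      unfolding c12 using component_le_norm_cart order_trans by blast+
    have "g x - g z = f (x - z)" by (simp add: g_def linear_diff[OF lin])
    then have "norm (g x - g z) < a"
      using x f by (simp add: S_def orthogonal_transformation_norm dist_norm norm_minus_commute)
    then have "\<bar>g x $ 3 - c\<bar> < a"
      using component_le_norm_cart[of "g x - g z" 3] by (simp add: c_def)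
    with 1 show "g x \<in> cbox (vector [-\<rho>, -\<rho>, c - a]) (vector [\<rho>, \<rho>, c + a])"
      by (auto simp: mem_box_cart forall_3)
  qed
  moreover have "g ` S \<in> lmeasurable" "measure lebesgue (g ` S) = measure lebesgue S"
    using measure_isometry[OF f(1) Sm, of "- f P"] by (simp_all add: g_def[abs_def])
  ultimately have "measure lebesgue S \<le> measure lebesgue (cbox (vector [-\<rho>, -\<rho>, c - a]) (vector [\<rho>, \<rho>, c + a]) :: (real^3) set)"
    using measure_mono_fmeasurable[of "g ` S" "cbox (vector [-\<rho>, -\<rho>, c - a]) (vector [\<rho>, \<rho>, c + a])" lebesgue]
    by (auto simp: fmeasurableD)
  also have "\<dots> = 8 * \<rho>\<^sup>2 * a"
    using \<rho> a by (simp add: measure_completion content_box3 power2_eq_square)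
  finally show "measure lebesgue S \<le> 8 * \<rho>\<^sup>2 * a" .
qed

text \<open>The tube contains a box with sides \<open>\<rho>\<close>, \<open>\<rho>\<close> and \<open>L\<close> around its axis.\<close>

lemma segment_nbhd_measure_ge:
  assumes \<rho>: "0 \<le> \<rho>" and L: "0 < L" "L \<le> dist P Q"
  shows "\<rho>\<^sup>2 * L \<le> measure lebesgue {x::real^3. infdist x (closed_segment P Q) \<le> \<rho>}" (is "_ \<le> measure lebesgue ?T")
    and "{x::real^3. infdist x (closed_segment P Q) \<le> \<rho>} \<in> lmeasurable"
proof -
  define l where "l = dist P Q"
  have l: "0 < l" "l = norm (Q - P)" using L by (auto simp: l_def dist_norm norm_minus_commute)
  define e where "e = (1 / l) *\<^sub>R (Q - P)"
  have "norm e = 1" using l by (simp add: e_def)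
  then obtain f where f: "orthogonal_transformation f" "f (axis 3 1 :: real^3) = e"
    using orthogonal_transformation_exists_1[of "axis 3 1 :: real^3" e] norm_axis_1 by metis
  have lin: "linear f" using f by (simp add: orthogonal_transformation_linear)
  let ?C = "cbox (vector [-\<rho>/2, -\<rho>/2, 0]) (vector [\<rho>/2, \<rho>/2, L]) :: (real^3) set"
  show T: "?T \<in> lmeasurable"
    by (intro lmeasurable_borel_bounded borel_closed closed_infdist_le bounded_segment_nbhd)
  have "(\<lambda>u. P + f u) ` ?C \<subseteq> ?T"
  proof (rule image_subsetI)
    fix u assume u: "u \<in> ?C"
    then have ub: "\<bar>u$1\<bar> \<le> \<rho>/2" "\<bar>u$2\<bar> \<le> \<rho>/2" "0 \<le> u$3" "u$3 \<le> L" by (auto simp: mem_box_cart forall_3)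
    define y where "y = P + (u$3) *\<^sub>R e"
    have "y = (1 - u$3 / l) *\<^sub>R P + (u$3 / l) *\<^sub>R Q" using l by (simp add: y_def e_def algebra_simps)
    moreover have "0 \<le> u$3 / l" "u$3 / l \<le> 1" using ub l L by (auto simp: l_def)
    ultimately have y: "y \<in> closed_segment P Q" by (auto simp: in_segment)
    have "f (u - (u$3) *\<^sub>R axis 3 1) = f u - (u$3) *\<^sub>R e"
      using linear_diff[OF lin] linear_scale[OF lin] f by simp
    then have "dist (P + f u) y = norm (f (u - (u$3) *\<^sub>R axis 3 1))"
      by (simp add: dist_norm y_def)
    also have "\<dots> = norm (u - (u$3) *\<^sub>R axis 3 1)" using f by (simp add: orthogonal_transformation_norm)
    also have "\<dots> \<le> \<rho>"
    proof (rule power2_le_imp_le)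
      have "\<bar>u$1\<bar>\<^sup>2 \<le> (\<rho>/2)\<^sup>2" "\<bar>u$2\<bar>\<^sup>2 \<le> (\<rho>/2)\<^sup>2" using ub by (intro power_mono; simp)+
      then have "(u$1)\<^sup>2 \<le> \<rho>\<^sup>2 / 4" "(u$2)\<^sup>2 \<le> \<rho>\<^sup>2 / 4" by (auto simp: power_divide)
      moreover have "(norm (u - (u$3) *\<^sub>R axis 3 1))\<^sup>2 = (u$1)\<^sup>2 + (u$2)\<^sup>2"
        by (simp add: norm_sq3 axis_def)
      ultimately show "(norm (u - (u$3) *\<^sub>R axis 3 1))\<^sup>2 \<le> \<rho>\<^sup>2" using zero_le_power2[of \<rho>] by linarith
    qed (rule \<rho>)
    finally have "infdist (P + f u) (closed_segment P Q) \<le> \<rho>" using infdist_le2[OF y] by blast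
    then show "P + f u \<in> ?T" by simp
  qed
  then have "measure lebesgue ((\<lambda>u. P + f u) ` ?C) \<le> measure lebesgue ?T"
    using measure_isometry[OF f(1), of ?C P] T by (intro measure_mono_fmeasurable) (auto simp: fmeasurableD)
  moreover have "measure lebesgue ((\<lambda>u. P + f u) ` ?C) = measure lebesgue ?C"
    using measure_isometry[OF f(1), of ?C P] by auto
  moreover have "measure lebesgue ?C = \<rho>\<^sup>2 * L"
    using \<rho> L by (simp add: measure_completion content_box3 power2_eq_square)
  ultimately show "\<rho>\<^sup>2 * L \<le> measure lebesgue ?T" by simp
qed

lemma compact_rect_box: "rect_box a b r B \<Longrightarrow> compact B"
proof -
  assume "rect_box a b r B"
  then obtain p :: "real^3" and f :: "real^3 \<Rightarrow> real^3" where f: "orthogonal_transformation f" "B = (\<lambda>x. p + f x) ` cbox 0 (vector [a, b, r])"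
    unfolding rect_box_def by blast
  have "continuous_on (cbox 0 (vector [a, b, r])) (\<lambda>x. p + f x)"
    using f by (intro continuous_intros linear_continuous_on) (simp add: orthogonal_transformation_linear linear_conv_bounded_linear[symmetric])
  then show ?thesis unfolding f by (intro compact_continuous_image) auto
qed

text \<open>Each side of the box is at least \<open>a\<close>, so from any of its points one can move by \<open>a / 2\<close> inward in every coordinate.\<close>

lemma rect_box_ball_measure:
  assumes B: "rect_box a b r B" and a: "0 < a" "a \<le> b" "b \<le> r" and y: "y \<in> B"
  shows "a ^ 3 / 8 \<le> measure lebesgue (B \<inter> ball y a)"
proof -
  obtain p :: "real^3" and f :: "real^3 \<Rightarrow> real^3" where f: "orthogonal_transformation f" "B = (\<lambda>x. p + f x) ` cbox 0 (vector [a, b, r])"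
    using B unfolding rect_box_def by blast
  have lin: "linear f" using f by (simp add: orthogonal_transformation_linear)
  obtain u where u: "u \<in> cbox 0 (vector [a, b, r])" "y = p + f u" using y f by auto
  have u': "0 \<le> u$1" "u$1 \<le> a" "0 \<le> u$2" "u$2 \<le> b" "0 \<le> u$3" "u$3 \<le> r"
    using u by (auto simp: mem_box_cart forall_3)
  \<comment> \<open>the lower corner, in one coordinate, of a cube of side \<open>a / 2\<close> that has \<open>u\<close> as a vertex and stays in the box\<close>
  define c where "c m t = (if t + a / 2 \<le> m then t else t - a / 2)" for m t :: real
  let ?C = "cbox (vector [c a (u$1), c b (u$2), c r (u$3)])
     (vector [c a (u$1) + a/2, c b (u$2) + a/2, c r (u$3) + a/2]) :: (real^3) set"
  have c: "0 \<le> c m t" "c m t + a / 2 \<le> m" "t - a / 2 \<le> c m t" "c m t \<le> t" if "0 \<le> t" "t \<le> m" "a \<le> m" for m t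
    using that a by (auto simp: c_def)
  have ar: "a \<le> r" using a by simp
  have "(\<lambda>x. p + f x) ` ?C \<subseteq> B \<inter> ball y a"
  proof (rule image_subsetI)
    fix x assume x: "x \<in> ?C"
    have "x \<in> cbox 0 (vector [a, b, r])"
      using x c(1,2)[OF u'(1,2)] c(1,2)[OF u'(3,4)] c(1,2)[OF u'(5,6)] a ar
      by (auto simp: mem_box_cart forall_3 intro: order_trans)
    moreover have "p + f x \<in> ball y a"
    proof -
      have "\<bar>x$1 - u$1\<bar> \<le> a/2" "\<bar>x$2 - u$2\<bar> \<le> a/2" "\<bar>x$3 - u$3\<bar> \<le> a/2"
      proof -
        have "c a (u$1) \<le> x$1" "x$1 \<le> c a (u$1) + a/2" "c b (u$2) \<le> x$2" "x$2 \<le> c b (u$2) + a/2"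
          "c r (u$3) \<le> x$3" "x$3 \<le> c r (u$3) + a/2"
          using x by (auto simp: mem_box_cart forall_3)
        then show "\<bar>x$1 - u$1\<bar> \<le> a/2" "\<bar>x$2 - u$2\<bar> \<le> a/2" "\<bar>x$3 - u$3\<bar> \<le> a/2"
          using c(3,4)[OF u'(1,2)] c(3,4)[OF u'(3,4)] c(3,4)[OF u'(5,6)] a ar by linarith+
      qed
      then have "\<bar>x$1 - u$1\<bar>\<^sup>2 \<le> (a/2)\<^sup>2" "\<bar>x$2 - u$2\<bar>\<^sup>2 \<le> (a/2)\<^sup>2" "\<bar>x$3 - u$3\<bar>\<^sup>2 \<le> (a/2)\<^sup>2"
        by (intro power_mono; simp)+
      then have "(norm (x - u))\<^sup>2 \<le> 3 * (a/2)\<^sup>2" by (simp add: norm_sq3)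
      also have "\<dots> < a\<^sup>2" using a by (simp add: power_divide)
      finally have "norm (x - u) < a" using a by (simp add: power2_less_imp_less)
      moreover have "dist y (p + f x) = norm (f (u - x))" by (simp add: u dist_norm linear_diff[OF lin])
      ultimately show ?thesis using f by (simp add: orthogonal_transformation_norm norm_minus_commute)
    qed
    ultimately show "p + f x \<in> B \<inter> ball y a" using f by auto
  qed
  moreover have "B \<inter> ball y a \<in> lmeasurable"
    by (rule fmeasurable.Int[OF lmeasurable_compact[OF compact_rect_box[OF B]] lmeasurable_ball])
  ultimately have "measure lebesgue ((\<lambda>x. p + f x) ` ?C) \<le> measure lebesgue (B \<inter> ball y a)"
    using measure_isometry[OF f(1), of ?C p] by (intro measure_mono_fmeasurable) (auto simp: fmeasurableD)
  moreover have "measure lebesgue ((\<lambda>x. p + f x) ` ?C) = measure lebesgue ?C"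
    using measure_isometry[OF f(1), of ?C p] by auto
  moreover have "measure lebesgue ?C = a ^ 3 / 8"
    using a by (simp add: measure_completion content_box3 power3_eq_cube)
  ultimately show ?thesis by simp
qed

lemma open_open_nbhd: "open (open_nbhd a E)"
  unfolding open_nbhd_def by (intro open_Collect_conj open_Collect_less continuous_intros) auto

lemma in_open_nbhdI: "y \<in> E \<Longrightarrow> dist x y < a \<Longrightarrow> x \<in> open_nbhd a E"
  unfolding open_nbhd_def using infdist_le[of y E x] by auto

lemma in_open_nbhdD: "x \<in> open_nbhd a E \<Longrightarrow> \<exists>y\<in>E. dist x y < a"
  unfolding open_nbhd_def using infdist_notempty[of E x] cINF_less_iff[of E "dist x" a] by auto

lemma box_inter_nbhd:
  assumes "rect_box a b r B"
  shows "B \<inter> open_nbhd h E \<in> sets borel" "B \<inter> open_nbhd h E \<in> lmeasurable"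
proof -
  have c: "compact B" using assms by (rule compact_rect_box)
  show "B \<inter> open_nbhd h E \<in> sets borel"
    by (intro sets.Int borel_closed[OF compact_imp_closed[OF c]] borel_open open_open_nbhd)
  then show "B \<inter> open_nbhd h E \<in> lmeasurable"
    by (rule lmeasurable_borel_bounded) (rule bounded_subset[OF compact_imp_bounded[OF c] Int_lower1])
qed

lemma emeasure_lborel_eq:
  assumes "S \<in> sets borel" "S \<in> lmeasurable"
  shows "emeasure lborel S = ennreal (measure lebesgue S)"
proof -
  have "emeasure lborel S = emeasure lebesgue S" using assms by simp
  also have "\<dots> = ennreal (measure lebesgue S)" by (rule emeasure_eq_measure2[OF assms(2)])
  finally show ?thesis .
qed

text \<open>Double counting of the pairs \<open>(x, y) \<in> B \<times> Y\<close> at distance less than \<open>a\<close>. Every \<open>y\<close> has at least \<open>a ^ 3 / 8\<close> worth of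
  partners \<open>x\<close> in the box. Conversely \<open>x\<close> has a partner only if it lies in the thickening, and then its partners lie in
  a piece of tube of measure at most \<open>8 * \<rho>\<^sup>2 * a\<close>. So thickening gains the ratio of the two cross sections.\<close>

lemma thickening_measure:
  assumes B: "rect_box a b r B" and a: "0 < a" "a \<le> b" "b \<le> r" and PQ: "P \<noteq> Q" and \<rho>: "0 \<le> \<rho>"
    and Y: "Y \<in> sets lebesgue" "Y \<subseteq> B" "Y \<subseteq> {x. infdist x (closed_segment P Q) \<le> \<rho>}"
  shows "a\<^sup>2 * measure lebesgue Y \<le> 64 * \<rho>\<^sup>2 * measure lebesgue (B \<inter> open_nbhd a Y)"
proof -
  \<comment> \<open>a Borel subset of full measure, for which the product measure is available\<close>
  define Z where "Z = main_part lborel Y"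
  have Zs: "Z \<in> sets borel" unfolding Z_def using main_part_sets[OF Y(1)] unfolding sets_lborel .
  have ZY: "Z \<subseteq> Y" unfolding Z_def by (subst (2) main_part_null_part_Un[OF Y(1), symmetric]) (rule Un_upper1)
  have mZ: "measure lebesgue Z = measure lebesgue Y"
  proof -
    have "emeasure lebesgue Z = emeasure lborel Z" using Zs by simp
    also have "\<dots> = emeasure lebesgue Y" unfolding Z_def by (rule emeasure_completion[OF Y(1), symmetric])
    finally show ?thesis unfolding measure_def by (rule arg_cong)
  qed
  have cB: "compact B" using B by (rule compact_rect_box)
  have Bs: "B \<in> sets borel" by (intro borel_closed compact_imp_closed cB)
  have bB: "bounded B" by (rule compact_imp_bounded[OF cB])
  have Zl: "Z \<in> lmeasurable"
    by (rule lmeasurable_borel_bounded[OF Zs bounded_subset[OF bB subset_trans[OF ZY Y(2)]]])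
  let ?W = "B \<inter> open_nbhd a Y"
  let ?E = "{w. fst w \<in> B \<and> snd w \<in> Z \<and> dist (fst w) (snd w) < a} :: ((real^3) \<times> (real^3)) set"
  have E: "?E \<in> sets (lborel \<Otimes>\<^sub>M lborel)"
  proof -
    have "?E = B \<times> Z \<inter> {w. dist (fst w) (snd w) < a}" by auto
    moreover have "{w :: (real^3) \<times> (real^3). dist (fst w) (snd w) < a} \<in> sets (borel \<Otimes>\<^sub>M borel)"
      unfolding borel_prod by (intro borel_open open_Collect_less continuous_intros)
    moreover have "B \<times> Z \<in> sets (borel \<Otimes>\<^sub>M borel)" using Bs Zs by (rule pair_measureI)
    ultimately have "?E \<in> sets (borel \<Otimes>\<^sub>M borel)" by (simp only: sets.Int)
    then show ?thesis unfolding sets_pair_measure_cong[OF sets_lborel sets_lborel] .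
  qed
  have 1: "emeasure (lborel \<Otimes>\<^sub>M lborel) ?E = (\<integral>\<^sup>+x. emeasure lborel (Pair x -` ?E) \<partial>lborel)"
    by (rule lborel.emeasure_pair_measure_alt[OF E])
  have 2: "emeasure (lborel \<Otimes>\<^sub>M lborel) ?E = (\<integral>\<^sup>+y. emeasure lborel ((\<lambda>x. (x, y)) -` ?E) \<partial>lborel)"
    by (rule lborel_pair.emeasure_pair_measure_alt2[OF E])
  have "(\<integral>\<^sup>+x. emeasure lborel (Pair x -` ?E) \<partial>lborel) \<le> (\<integral>\<^sup>+x. ennreal (8 * \<rho>\<^sup>2 * a) * indicator ?W x \<partial>lborel)"
  proof (rule nn_integral_mono)
    fix x
    show "emeasure lborel (Pair x -` ?E) \<le> ennreal (8 * \<rho>\<^sup>2 * a) * indicator ?W x"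
    proof (cases "x \<in> ?W")
      case True
      let ?S = "{x. infdist x (closed_segment P Q) \<le> \<rho>} \<inter> ball x a"
      note S = segment_nbhd_ball_measure[OF PQ \<rho> a(1), of x]
      have "Pair x -` ?E \<subseteq> ?S"
      proof
        fix y assume "y \<in> Pair x -` ?E"
        then have "y \<in> Z" "dist x y < a" by simp_all
        then show "y \<in> ?S" using subsetD[OF subset_trans[OF ZY Y(3)]] by simp
      qed
      then have "emeasure lborel (Pair x -` ?E) \<le> emeasure lborel ?S"
        by (rule emeasure_mono) (simp add: S(1))
      also have "\<dots> = ennreal (measure lebesgue ?S)" using S by (intro emeasure_lborel_eq)
      also have "\<dots> \<le> ennreal (8 * \<rho>\<^sup>2 * a)" using S(3) by (rule ennreal_leI)
      finally show ?thesis using True by simp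
    next
      case False
      have "Pair x -` ?E = {}"
      proof (rule equals0I)
        fix y assume "y \<in> Pair x -` ?E"
        then have "x \<in> B" "y \<in> Z" "dist x y < a" by simp_all
        then have "x \<in> ?W" using in_open_nbhdI[of y Y x a] ZY by blast
        with False show False by contradiction
      qed
      then show ?thesis by (simp only: emeasure_empty) simp
    qed
  qed
  also have "\<dots> = ennreal (8 * \<rho>\<^sup>2 * a) * emeasure lborel ?W"
    using box_inter_nbhd[OF B] by (intro nn_integral_cmult_indicator) simp
  also have "\<dots> = ennreal (8 * \<rho>\<^sup>2 * a * measure lebesgue ?W)"
    using emeasure_lborel_eq[OF box_inter_nbhd[OF B]] a by (simp add: ennreal_mult)
  finally have up: "emeasure (lborel \<Otimes>\<^sub>M lborel) ?E \<le> ennreal (8 * \<rho>\<^sup>2 * a * measure lebesgue ?W)"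
    unfolding 1 .
  have "ennreal (a ^ 3 / 8 * measure lebesgue Z) = (\<integral>\<^sup>+y. ennreal (a ^ 3 / 8) * indicator Z y \<partial>lborel)"
  proof -
    have "(\<integral>\<^sup>+y. ennreal (a ^ 3 / 8) * indicator Z y \<partial>lborel) = ennreal (a ^ 3 / 8) * emeasure lborel Z"
      using Zs by (intro nn_integral_cmult_indicator) simp
    also have "\<dots> = ennreal (a ^ 3 / 8 * measure lebesgue Z)"
      unfolding emeasure_lborel_eq[OF Zs Zl] using a by (intro ennreal_mult[symmetric]) auto
    finally show ?thesis by (rule sym)
  qed
  also have "\<dots> \<le> (\<integral>\<^sup>+y. emeasure lborel ((\<lambda>x. (x, y)) -` ?E) \<partial>lborel)"
  proof (rule nn_integral_mono)
    fix y
    show "ennreal (a ^ 3 / 8) * indicator Z y \<le> emeasure lborel ((\<lambda>x. (x, y)) -` ?E)"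
    proof (cases "y \<in> Z")
      case True
      have eq: "(\<lambda>x. (x, y)) -` ?E = B \<inter> ball y a" using True by (auto simp: dist_commute)
      have yB: "y \<in> B" using True ZY Y by auto
      have "emeasure lborel (B \<inter> ball y a) = ennreal (measure lebesgue (B \<inter> ball y a))"
        using bB Bs by (intro emeasure_lborel_eq lmeasurable_borel_bounded) (auto intro: bounded_subset)
      then show ?thesis unfolding eq using True rect_box_ball_measure[OF B a yB] by (simp add: ennreal_leI)
    qed simp
  qed
  finally have "ennreal (a ^ 3 / 8 * measure lebesgue Z) \<le> ennreal (8 * \<rho>\<^sup>2 * a * measure lebesgue ?W)"
    using up unfolding 2 by (rule order_trans)
  then have "a ^ 3 / 8 * measure lebesgue Z \<le> 8 * \<rho>\<^sup>2 * a * measure lebesgue ?W"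
    using a by (subst (asm) ennreal_le_iff) auto
  then have "a * (a\<^sup>2 * measure lebesgue Y) \<le> a * (64 * \<rho>\<^sup>2 * measure lebesgue ?W)"
    by (simp add: mZ power3_eq_cube power2_eq_square mult_ac)
  then show ?thesis using a by simp
qed

section \<open>Rescaling the box to the unit cube\<close>

definition stretch3 :: "real \<Rightarrow> real \<Rightarrow> real \<Rightarrow> real^3 \<Rightarrow> real^3" where
  "stretch3 a b r z = (\<chi> k. vector [a, b, r] $ k * z $ k)"

text \<open>The affine map that takes the unit cube to the box at \<open>p\<close> with sides \<open>a\<close>, \<open>b\<close>, \<open>r\<close> in the frame \<open>f\<close>.\<close>

definition chart :: "real^3 \<Rightarrow> (real^3 \<Rightarrow> real^3) \<Rightarrow> real \<Rightarrow> real \<Rightarrow> real \<Rightarrow> real^3 \<Rightarrow> real^3" where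
  "chart p f a b r z = p + f (stretch3 a b r z)"

lemma stretch3_nth [simp]:
  "stretch3 a b r z $ 1 = a * z $ 1" "stretch3 a b r z $ 2 = b * z $ 2" "stretch3 a b r z $ 3 = r * z $ 3"
  by (simp_all add: stretch3_def)

lemma linear_stretch3: "linear (stretch3 a b r)"
  by (rule linearI) (simp_all add: vec_eq_iff forall_3 algebra_simps)

lemma chart_measure:
  assumes f: "orthogonal_transformation f" and pos: "0 < a" "0 < b" "0 < r" and S: "S \<in> lmeasurable"
  shows "measure lebesgue (chart p f a b r ` S) = a * b * r * measure lebesgue S"
    "chart p f a b r ` S \<in> lmeasurable"
proof -
  have e: "chart p f a b r ` S = (\<lambda>x. p + f x) ` (stretch3 a b r ` S)"
    by (simp add: chart_def image_image)
  have st: "stretch3 a b r ` S \<in> lmeasurable" "measure lebesgue (stretch3 a b r ` S) = a * b * r * measure lebesgue S"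
    using measurable_stretch[OF S, of "\<lambda>k. vector [a, b, r] $ k"] measure_stretch[OF S, of "\<lambda>k. vector [a, b, r] $ k"] pos
    by (simp_all add: stretch3_def[abs_def] prod_UNIV_3)
  show "measure lebesgue (chart p f a b r ` S) = a * b * r * measure lebesgue S"
    unfolding e measure_isometry(1)[OF f st(1)] by (rule st(2))
  show "chart p f a b r ` S \<in> lmeasurable"
    unfolding e by (rule measure_isometry(2)[OF f st(1)])
qed

lemma chart_unit_cube:
  assumes "0 < a" "0 < b" "0 < r"
  shows "chart p f a b r ` cbox 0 1 = (\<lambda>x. p + f x) ` cbox 0 (vector [a, b, r])"
proof -
  have "stretch3 a b r ` cbox 0 1 = cbox 0 (vector [a, b, r])"
  proof
    show "stretch3 a b r ` cbox 0 1 \<subseteq> cbox 0 (vector [a, b, r])"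
      using assms by (auto simp: mem_box_cart forall_3 mult_left_le)
    show "cbox 0 (vector [a, b, r]) \<subseteq> stretch3 a b r ` cbox 0 1"
    proof
      fix y :: "real^3" assume y: "y \<in> cbox 0 (vector [a, b, r])"
      define z :: "real^3" where "z = vector [y$1 / a, y$2 / b, y$3 / r]"
      have "stretch3 a b r z = y" using assms by (simp add: vec_eq_iff forall_3 z_def)
      moreover have "z \<in> cbox 0 1" using y assms by (auto simp: mem_box_cart forall_3 z_def)
      ultimately show "y \<in> stretch3 a b r ` cbox 0 1" by blast
    qed
  qed
  moreover have "chart p f a b r ` cbox 0 1 = (\<lambda>x. p + f x) ` (stretch3 a b r ` cbox 0 1)"
    by (simp add: chart_def image_image)
  ultimately show ?thesis by simp
qed

text \<open>Undoing the chart divides the second and third coordinates by \<open>b\<close> and \<open>r\<close>, and \<open>r \<ge> b\<close>. Hence distances at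
  scale \<open>a\<close> in the box become heights at scale \<open>a / b\<close>.\<close>

lemma height_chart_lipschitz:
  assumes f: "orthogonal_transformation f" and "0 < b" "b \<le> r"
  shows "\<bar>height \<psi> z - height \<psi> z'\<bar> * b \<le> dist (chart p f a b r z) (chart p f a b r z')"
proof -
  define d where "d = z - z'"
  have "dist (chart p f a b r z) (chart p f a b r z') = norm (f (stretch3 a b r d))"
    using orthogonal_transformation_linear[OF f]
    by (simp add: chart_def dist_norm d_def linear_diff linear_diff[OF linear_stretch3])
  also have "\<dots> = norm (stretch3 a b r d)" using f by (simp add: orthogonal_transformation_norm)
  finally have n: "dist (chart p f a b r z) (chart p f a b r z') = norm (stretch3 a b r d)" .
  have "(\<bar>height \<psi> d\<bar> * b)\<^sup>2 \<le> (sqrt ((d$2)^2 + (d$3)^2) * b)\<^sup>2"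
    using assms abs_height_le[of \<psi> d] by (intro power_mono mult_right_mono) auto
  also have "\<dots> = b\<^sup>2 * (d$2)\<^sup>2 + b\<^sup>2 * (d$3)\<^sup>2" by (simp add: power_mult_distrib algebra_simps)
  also have "\<dots> \<le> (a * d$1)\<^sup>2 + (b * d$2)\<^sup>2 + (r * d$3)\<^sup>2"
  proof -
    have "b\<^sup>2 * (d$3)\<^sup>2 \<le> r\<^sup>2 * (d$3)\<^sup>2" using assms by (intro mult_right_mono power_mono) auto
    then show ?thesis using zero_le_power2[of "a * d$1"] unfolding power_mult_distrib by linarith
  qed
  also have "\<dots> = (norm (stretch3 a b r d))\<^sup>2" by (simp add: norm_sq3)
  finally have "\<bar>height \<psi> d\<bar> * b \<le> norm (stretch3 a b r d)"
    using assms by (intro power2_le_imp_le[of "\<bar>height \<psi> d\<bar> * b"]) auto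
  then show ?thesis unfolding n by (simp add: d_def height_diff)
qed

lemma chart_affine:
  assumes f: "orthogonal_transformation f"
  shows "chart p f a b r ((1 - u) *\<^sub>R z + u *\<^sub>R z') = (1 - u) *\<^sub>R chart p f a b r z + u *\<^sub>R chart p f a b r z'"
proof -
  have l: "linear (\<lambda>z. f (stretch3 a b r z))"
    using linear_compose[OF linear_stretch3 orthogonal_transformation_linear[OF f]] by (simp add: o_def)
  have "f (stretch3 a b r ((1 - u) *\<^sub>R z + u *\<^sub>R z')) = (1 - u) *\<^sub>R f (stretch3 a b r z) + u *\<^sub>R f (stretch3 a b r z')"
    by (simp only: linear_add[OF l] linear_scale[OF l])
  then show ?thesis by (simp add: chart_def algebra_simps)
qed

lemma norm_unit_cube: "z \<in> cbox 0 (1::real^3) \<Longrightarrow> norm z \<le> 2"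
proof (rule power2_le_imp_le)
  assume z: "z \<in> cbox 0 (1::real^3)"
  then have "\<bar>z$1\<bar>\<^sup>2 \<le> 1" "\<bar>z$2\<bar>\<^sup>2 \<le> 1" "\<bar>z$3\<bar>\<^sup>2 \<le> 1"
    by (auto simp: mem_box_cart forall_3 power_le_one)
  then show "(norm z)\<^sup>2 \<le> 2\<^sup>2" by (simp add: norm_sq3)
qed simp

text \<open>Two points always lie on a common level set of some \<open>height \<phi>\<close>. The bound on \<open>\<phi>\<close> keeps the net of angles in
  \<open>wide_sum_le\<close> finite.\<close>

lemma exists_normal_angle: "\<exists>\<phi>. \<bar>\<phi>\<bar> \<le> 2 \<and> height \<phi> p = height \<phi> q"
proof (cases "(p - q)$3 = 0")
  case True
  then have "height (pi / 2) p = height (pi / 2) q" by (simp add: height_def)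
  then show ?thesis using pi_less_4 pi_gt_zero by (intro exI[of _ "pi/2"]) auto
next
  case False
  define \<phi> where "\<phi> = arctan (- (p - q)$2 / (p - q)$3)"
  have "cos \<phi> \<noteq> 0" by (simp add: \<phi>_def)
  then have "sin \<phi> = tan \<phi> * cos \<phi>" by (simp add: tan_def)
  then have "height \<phi> (p - q) = cos \<phi> * ((p - q)$2 + tan \<phi> * (p - q)$3)" by (simp add: height_def algebra_simps)
  also have "tan \<phi> * (p - q)$3 = - (p - q)$2" using False unfolding \<phi>_def tan_arctan by simp
  finally have "height \<phi> p = height \<phi> q" by (simp add: height_diff)
  moreover have "\<bar>\<phi>\<bar> \<le> 2" using arctan_bounded[of "- (p - q)$2 / (p - q)$3"] pi_less_4 unfolding \<phi>_def by linarith
  ultimately show ?thesis by blast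
qed

text \<open>The chart is affine, so the two end points of a segment control its heights.\<close>

lemma height_on_segment:
  assumes f: "orthogonal_transformation f" and P: "chart c f a b r p = P" "chart c f a b r q = Q"
    and y: "y \<in> closed_segment P Q"
  shows "\<exists>v. chart c f a b r v = y \<and> (\<forall>\<psi> \<tau> w. \<bar>height \<psi> p - \<tau>\<bar> \<le> w \<longrightarrow> \<bar>height \<psi> q - \<tau>\<bar> \<le> w \<longrightarrow> \<bar>height \<psi> v - \<tau>\<bar> \<le> w)"
proof -
  obtain u where u: "0 \<le> u" "u \<le> 1" "y = (1 - u) *\<^sub>R P + u *\<^sub>R Q" using y by (auto simp: in_segment)
  define v where "v = (1 - u) *\<^sub>R p + u *\<^sub>R q"
  have "chart c f a b r v = y" unfolding v_def chart_affine[OF f] P u by simp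
  moreover have "\<bar>height \<psi> v - \<tau>\<bar> \<le> w" if w: "\<bar>height \<psi> p - \<tau>\<bar> \<le> w" "\<bar>height \<psi> q - \<tau>\<bar> \<le> w" for \<psi> \<tau> w
  proof -
    have "height \<psi> v - \<tau> = (1 - u) * (height \<psi> p - \<tau>) + u * (height \<psi> q - \<tau>)"
      unfolding v_def height_add height_scale by (simp add: algebra_simps)
    also have "\<bar>\<dots>\<bar> \<le> \<bar>1 - u\<bar> * \<bar>height \<psi> p - \<tau>\<bar> + \<bar>u\<bar> * \<bar>height \<psi> q - \<tau>\<bar>"
      unfolding abs_mult[symmetric] by (rule abs_triangle_ineq)
    also have "\<dots> \<le> (1 - u) * w + u * w"
      using u w by (intro add_mono mult_mono) auto
    finally show ?thesis by (simp add: algebra_simps)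
  qed
  ultimately show ?thesis by blast
qed

text \<open>The whole box contains all the tubes.\<close>

lemma concentration_const_ge_1:
  assumes C: "convex_concentration_bound C\<^sub>0 \<sigma> B I T" and "convex B" "0 < measure lebesgue B"
    and I: "finite I" "1 \<le> card I" and T: "\<And>i. i \<in> I \<Longrightarrow> T i \<subseteq> B"
  shows "1 \<le> C\<^sub>0"
proof -
  have "{i \<in> I. T i \<subseteq> B} = I" using T by auto
  moreover have "I \<noteq> {}" using I by auto
  ultimately show ?thesis
  proof -
    have "real (card {i \<in> I. T i \<subseteq> B}) / real (card I) \<le> C\<^sub>0 * (measure lebesgue B / measure lebesgue B) powr (1 + \<sigma>)"
      using C assms(2) unfolding convex_concentration_bound_def by blast
    then show ?thesis using assms(3) I \<open>{i \<in> I. T i \<subseteq> B} = I\<close> \<open>I \<noteq> {}\<close> by simp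
  qed
qed

text \<open>The part of the box over a slab of half-width \<open>2 * w\<close> is convex of relative volume \<open>O(w)\<close>, and it swallows every tube whose
  axis has its end points within \<open>w\<close> of the centre of the slab, because the tube radius is at most \<open>w\<close> after rescaling.\<close>

lemma concentration_imp_slab_count:
  assumes f: "orthogonal_transformation f" and a: "0 < a" "a \<le> b" "b \<le> r"
    and B: "B = chart c f a b r ` cbox 0 1"
    and C: "convex_concentration_bound C\<^sub>0 \<sigma> B I T" "0 \<le> C\<^sub>0" and I: "finite I" "1 \<le> card I" and \<sigma>: "0 < \<sigma>" "\<sigma> \<le> 1"
    and T: "\<And>i. i \<in> I \<Longrightarrow> T i = {x. infdist x (closed_segment (P i) (Q i)) \<le> \<rho> i} \<and> T i \<subseteq> B \<and> \<rho> i \<le> s * b"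
    and p: "\<And>i. i \<in> I \<Longrightarrow> chart c f a b r (p i) = P i \<and> chart c f a b r (q i) = Q i"
    and w: "0 < s" "s \<le> w"
  shows "real (card {i \<in> I. \<bar>height \<psi> (p i) - \<tau>\<bar> \<le> w \<and> \<bar>height \<psi> (q i) - \<tau>\<bar> \<le> w})
      \<le> 20736 * C\<^sub>0 * card I * w powr (1 + \<sigma>)"
proof -
  have pos: "0 < a" "0 < b" "0 < r" using a by auto
  define S where "S = cbox 0 1 \<inter> {z. \<bar>height \<psi> z - \<tau>\<bar> \<le> 2 * w}"
  define K where "K = chart c f a b r ` S"
  have Sb: "S \<subseteq> bounded_slab \<psi> (\<tau> - 2 * w) (\<tau> + 2 * w)"
    using norm_unit_cube by (force simp: S_def intro!: in_bounded_slab)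
  have Scl: "S \<in> sets borel"
  proof -
    have "closed {z. \<bar>height \<psi> z - \<tau>\<bar> \<le> 2 * w}" by (intro closed_Collect_le continuous_intros)
    then show ?thesis unfolding S_def by (intro sets.Int borel_closed closed_cbox)
  qed
  have Sm: "S \<in> lmeasurable"
    by (rule lmeasurable_borel_bounded[OF Scl]) (auto simp: S_def intro: bounded_subset[OF bounded_cbox])
  have mS: "measure lebesgue S \<le> 144 * w"
  proof -
    note bs = bounded_slab[of "\<tau> - 2 * w" "\<tau> + 2 * w" \<psi>]
    have "measure lebesgue S \<le> measure lebesgue (bounded_slab \<psi> (\<tau> - 2 * w) (\<tau> + 2 * w))"
      using Sb Sm bs w by (intro measure_mono_fmeasurable) (auto simp: fmeasurableD)
    also have "\<dots> \<le> 144 * w" using bs w by (simp add: measure_completion)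
    finally show ?thesis .
  qed
  have mB: "measure lebesgue B = a * b * r"
    unfolding B using chart_measure(1)[OF f pos, of "cbox 0 1" c] by (simp add: content_cbox_if_cart measure_completion interval_eq_empty_cart)
  have mK: "measure lebesgue K / measure lebesgue B = measure lebesgue S"
    unfolding mB K_def chart_measure(1)[OF f pos Sm] using pos by simp
  have convS: "convex S"
  proof -
    have "convex {z. \<bar>height \<psi> z - \<tau>\<bar> \<le> 2 * w}"
    proof (rule convexI)
      fix x y :: "real^3" and u v :: real
      assume x: "x \<in> {z. \<bar>height \<psi> z - \<tau>\<bar> \<le> 2 * w}" and y: "y \<in> {z. \<bar>height \<psi> z - \<tau>\<bar> \<le> 2 * w}" and uv: "0 \<le> u" "0 \<le> v" "u + v = 1"
      have "height \<psi> (u *\<^sub>R x + v *\<^sub>R y) - \<tau> = u * (height \<psi> x - \<tau>) + v * (height \<psi> y - \<tau>)"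
      proof -
        have "\<tau> = u * \<tau> + v * \<tau>" using uv by (simp flip: distrib_right)
        then show ?thesis unfolding height_add height_scale right_diff_distrib by linarith
      qed
      also have "\<bar>\<dots>\<bar> \<le> \<bar>u\<bar> * \<bar>height \<psi> x - \<tau>\<bar> + \<bar>v\<bar> * \<bar>height \<psi> y - \<tau>\<bar>"
        unfolding abs_mult[symmetric] by (rule abs_triangle_ineq)
      also have "\<dots> \<le> u * (2 * w) + v * (2 * w)" using x y uv by (intro add_mono mult_mono) auto
      also have "\<dots> = 2 * w" using uv by (simp flip: distrib_right)
      finally show "u *\<^sub>R x + v *\<^sub>R y \<in> {z. \<bar>height \<psi> z - \<tau>\<bar> \<le> 2 * w}" by simp
    qed
    then show ?thesis unfolding S_def by (intro convex_Int convex_box)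
  qed
  have convK: "convex K"
  proof -
    have "K = (+) c ` ((\<lambda>z. f (stretch3 a b r z)) ` S)" by (auto simp: K_def chart_def)
    moreover have "linear (\<lambda>z. f (stretch3 a b r z))"
      using linear_compose[OF linear_stretch3 orthogonal_transformation_linear[OF f]] by (simp add: o_def)
    ultimately show ?thesis using convS by (simp only: convex_translation convex_linear_image)
  qed
  have KB: "K \<subseteq> B" unfolding K_def B S_def by blast
  have TK: "T i \<subseteq> K" if i: "i \<in> I" "\<bar>height \<psi> (p i) - \<tau>\<bar> \<le> w" "\<bar>height \<psi> (q i) - \<tau>\<bar> \<le> w" for i
  proof
    fix x assume x: "x \<in> T i"
    obtain z where z: "z \<in> cbox 0 1" "x = chart c f a b r z" using x T[OF i(1)] unfolding B by blast
    have "infdist x (closed_segment (P i) (Q i)) \<le> \<rho> i" using x T[OF i(1)] by simp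
    then obtain y where y: "y \<in> closed_segment (P i) (Q i)" "dist x y \<le> \<rho> i"
      using infdist_segment_attained by blast
    obtain v where v: "chart c f a b r v = y" "\<bar>height \<psi> v - \<tau>\<bar> \<le> w"
      using height_on_segment[OF f _ _ y(1), of c a b r "p i" "q i"] p[OF i(1)] i by blast
    have "\<bar>height \<psi> z - height \<psi> v\<bar> * b \<le> dist x y"
      unfolding z v(1)[symmetric] using pos a by (intro height_chart_lipschitz[OF f]) auto
    also have "\<dots> \<le> s * b" using y T[OF i(1)] by simp
    finally have "\<bar>height \<psi> z - height \<psi> v\<bar> \<le> s" using pos by simp
    then have "\<bar>height \<psi> z - \<tau>\<bar> \<le> 2 * w" using v w by linarith
    then show "x \<in> K" using z by (auto simp: K_def S_def)
  qed
  have "card {i \<in> I. \<bar>height \<psi> (p i) - \<tau>\<bar> \<le> w \<and> \<bar>height \<psi> (q i) - \<tau>\<bar> \<le> w} \<le> card {i \<in> I. T i \<subseteq> K}"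
    using I TK by (intro card_mono) auto
  also have "real (card {i \<in> I. T i \<subseteq> K}) / real (card I) \<le> C\<^sub>0 * measure lebesgue S powr (1 + \<sigma>)"
    using C(1) convK KB unfolding convex_concentration_bound_def mK[symmetric] by blast
  then have "real (card {i \<in> I. T i \<subseteq> K}) \<le> C\<^sub>0 * measure lebesgue S powr (1 + \<sigma>) * card I"
    using I by (simp add: divide_le_eq)
  also have "\<dots> \<le> C\<^sub>0 * (20736 * w powr (1 + \<sigma>)) * card I"
  proof (intro mult_right_mono mult_left_mono)
    have "measure lebesgue S powr (1 + \<sigma>) \<le> (144 * w) powr (1 + \<sigma>)"
      using mS \<sigma> by (intro powr_mono2) auto
    also have "\<dots> = 144 powr (1 + \<sigma>) * w powr (1 + \<sigma>)" using w by (simp add: powr_mult)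
    also have "\<dots> \<le> 144 powr 2 * w powr (1 + \<sigma>)"
      using \<sigma> by (intro mult_right_mono powr_mono) auto
    finally show "measure lebesgue S powr (1 + \<sigma>) \<le> 20736 * w powr (1 + \<sigma>)" by simp
  qed (use C in auto)
  finally show ?thesis by (simp add: mult_ac)
qed

text \<open>The ratio of \<open>64 * (Crad * \<delta>)\<^sup>2\<close>, from thickening a shading, to the lower bound for the volume of a tube; the powers of
  \<open>\<delta>\<close> cancel.\<close>

definition thickening_const :: "real \<Rightarrow> real \<Rightarrow> real \<Rightarrow> real" where
  "thickening_const crad Crad clen = 64 * Crad\<^sup>2 / (crad\<^sup>2 * clen)"

text \<open>Here \<open>20736 = 144\<^sup>2\<close> comes from slabs of relative volume at most \<open>144 * w\<close>. The first summand serves \<open>s < 1\<close> and the second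
  \<open>s \<ge> 1\<close>, where \<open>s\<close> is the rescaled width of the thickened tubes.\<close>

definition projection_const :: "real \<Rightarrow> real \<Rightarrow> real \<Rightarrow> real \<Rightarrow> real" where
  "projection_const crad Crad clen \<sigma> =
     20736 * (1 + thickening_const crad Crad clen * (1 + Crad) * incidence_const \<sigma>) powr (2 - \<sigma>)
       + thickening_const crad Crad clen * (1 + Crad)"

text \<open>Write \<open>s = (1 + Crad) * a / b\<close>. Points of the box within \<open>a\<close> of the shading of tube \<open>i\<close> lie in the strip of half-width \<open>s\<close>
  about line \<open>i\<close>, once the box is rescaled. So \<open>thickening_measure\<close> bounds the density below the average mass that the
  thickened union \<open>W\<close> puts on these strips, and \<open>incidence_mass\<close> bounds that mass. If \<open>s \<ge> 1\<close>, then \<open>a\<close> and \<open>b\<close> are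
  comparable, and averaging the measures of the thickened single shadings is enough.\<close>

lemma projection_bound:
  assumes cr: "0 < crad" "crad \<le> Crad" and cl: "0 < clen" and \<sigma>: "0 < \<sigma>" "\<sigma> \<le> 1"
    and a: "0 < \<delta>" "\<delta> \<le> a" "a \<le> b" "b \<le> r" and B: "rect_box a b r B"
    and sh: "shaded_tubes_in_box crad Crad clen Clen \<delta> r B I T Y"
    and C: "convex_concentration_bound C\<^sub>0 \<sigma> B I T"
  shows "1 \<le> C\<^sub>0" and "0 \<le> shading_density I T Y"
    and "shading_density I T Y powr (2 - \<sigma>) * measure lebesgue B
      \<le> projection_const crad Crad clen \<sigma> * C\<^sub>0 * measure lebesgue (B \<inter> open_nbhd a (\<Union>i\<in>I. Y i))"
proof -
  have pos: "0 < a" "0 < b" "0 < r" using a by auto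
  obtain c :: "real^3" and f :: "real^3 \<Rightarrow> real^3" where f: "orthogonal_transformation f"
    and B0: "B = (\<lambda>x. c + f x) ` cbox 0 (vector [a, b, r])"
    using B unfolding rect_box_def by blast
  let ?\<Phi> = "chart c f a b r"
  have B1: "B = ?\<Phi> ` cbox 0 1" unfolding B0 chart_unit_cube[OF pos] ..
  have mB: "measure lebesgue B = a * b * r"
    unfolding B1 using chart_measure(1)[OF f pos, of "cbox 0 1" c] by (simp add: content_cbox_if_cart measure_completion interval_eq_empty_cart)
  have I: "finite I" "1 \<le> card I" using sh by (auto simp: shaded_tubes_in_box_def)
  have "\<forall>i\<in>I. \<exists>P Q \<rho>. clen * r \<le> dist P Q \<and> crad * \<delta> \<le> \<rho> \<and> \<rho> \<le> Crad * \<delta> \<and> T i = {x. infdist x (closed_segment P Q) \<le> \<rho>}"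
    using sh unfolding shaded_tubes_in_box_def is_tube_def by blast
  then obtain P Q \<rho> where PQ: "\<And>i. i \<in> I \<Longrightarrow> clen * r \<le> dist (P i) (Q i) \<and> crad * \<delta> \<le> \<rho> i \<and> \<rho> i \<le> Crad * \<delta> \<and> T i = {x. infdist x (closed_segment (P i) (Q i)) \<le> \<rho> i}"
    by metis
  have TB: "T i \<subseteq> B" and Ym: "Y i \<in> sets lebesgue" and YT: "Y i \<subseteq> T i" if "i \<in> I" for i
    using sh that by (auto simp: shaded_tubes_in_box_def)
  have \<rho>0: "0 < \<rho> i" if "i \<in> I" for i
  proof -
    have "0 < crad * \<delta>" using cr a by simp
    then show ?thesis using PQ[OF that] by linarith
  qed
  have PB: "P i \<in> B" "Q i \<in> B" if i: "i \<in> I" for i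
  proof -
    have "P i \<in> T i" "Q i \<in> T i" using PQ[OF i] \<rho>0[OF i] by (auto simp: infdist_zero)
    then show "P i \<in> B" "Q i \<in> B" using TB[OF i] by auto
  qed
  have "\<forall>i\<in>I. \<exists>p q \<phi>. p \<in> cbox 0 1 \<and> q \<in> cbox 0 1 \<and> ?\<Phi> p = P i \<and> ?\<Phi> q = Q i \<and> \<bar>\<phi>\<bar> \<le> 2 \<and> height \<phi> p = height \<phi> q"
  proof
    fix i assume "i \<in> I"
    then have "P i \<in> ?\<Phi> ` cbox 0 1" "Q i \<in> ?\<Phi> ` cbox 0 1" using PB unfolding B1 by simp_all
    then obtain p q where "p \<in> cbox 0 1" "q \<in> cbox 0 1" "?\<Phi> p = P i" "?\<Phi> q = Q i" by force
    then show "\<exists>p q \<phi>. p \<in> cbox 0 1 \<and> q \<in> cbox 0 1 \<and> ?\<Phi> p = P i \<and> ?\<Phi> q = Q i \<and> \<bar>\<phi>\<bar> \<le> 2 \<and> height \<phi> p = height \<phi> q"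
      using exists_normal_angle[of p q] by blast
  qed
  then obtain p q \<phi> where pq: "\<And>i. i \<in> I \<Longrightarrow> p i \<in> cbox 0 1 \<and> q i \<in> cbox 0 1 \<and> ?\<Phi> (p i) = P i \<and> ?\<Phi> (q i) = Q i \<and> \<bar>\<phi> i\<bar> \<le> 2 \<and> height (\<phi> i) (p i) = height (\<phi> i) (q i)"
    by metis
  define t where "t i = height (\<phi> i) (p i)" for i
  define s where "s = (1 + Crad) * a / b"
  have Cr: "0 < Crad" using cr by simp
  have s0: "0 < s" using pos Cr by (simp add: s_def)
  have sb: "s * b = (1 + Crad) * a" using pos by (simp add: s_def)
  have \<rho>a: "\<rho> i \<le> Crad * a" if "i \<in> I" for i
    using PQ[OF that] mult_left_mono[OF a(2), of Crad] Cr by linarith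
  have \<rho>s: "\<rho> i \<le> s * b" if "i \<in> I" for i
    unfolding sb using \<rho>a[OF that] pos by (simp add: algebra_simps)
  have convB: "convex B"
  proof -
    have "B = (+) c ` (f ` cbox 0 (vector [a, b, r]))" by (auto simp: B0)
    then show ?thesis
      by (simp only: convex_translation convex_linear_image[OF orthogonal_transformation_linear[OF f]] convex_box)
  qed
  show C1: "1 \<le> C\<^sub>0"
    using concentration_const_ge_1[OF C convB _ I TB] mB pos by simp
  define G where "G = thickening_const crad Crad clen"
  have G: "0 < G" using cr cl by (simp add: G_def thickening_const_def)
  define W where "W = B \<inter> open_nbhd a (\<Union>i\<in>I. Y i)"
  define m where "m i = measure lebesgue (B \<inter> open_nbhd a (Y i))" for i
  define n where "n = real (card I)"
  have n0: "0 < n" using I by (simp add: n_def)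
  have Wb: "W \<in> sets borel" "W \<in> lmeasurable" using box_inter_nbhd[OF B] by (auto simp: W_def)
  have subW: "B \<inter> open_nbhd a (Y i) \<subseteq> W" if "i \<in> I" for i
    using that by (auto simp: W_def dest!: in_open_nbhdD intro!: in_open_nbhdI)
  have Tm: "T i \<in> lmeasurable" and Tge: "crad\<^sup>2 * \<delta>\<^sup>2 * (clen * r) \<le> measure lebesgue (T i)" if i: "i \<in> I" for i
  proof -
    have "(crad * \<delta>)\<^sup>2 * (clen * r) \<le> (\<rho> i)\<^sup>2 * (clen * r)"
      using PQ[OF i] cr a cl pos by (intro mult_right_mono power_mono) auto
    also have "\<dots> \<le> measure lebesgue (T i)"
      using PQ[OF i] segment_nbhd_measure_ge(1)[of "\<rho> i" "clen * r" "P i" "Q i"] \<rho>0[OF i] cl pos by simp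
    finally show "crad\<^sup>2 * \<delta>\<^sup>2 * (clen * r) \<le> measure lebesgue (T i)" by (simp add: power_mult_distrib)
    show "T i \<in> lmeasurable"
      using PQ[OF i] segment_nbhd_measure_ge(2)[of "\<rho> i" "clen * r" "P i" "Q i"] \<rho>0[OF i] cl pos by simp
  qed
  have PneQ: "P i \<noteq> Q i" if i: "i \<in> I" for i
    using PQ[OF i] cl pos by (metis dist_self mult_pos_pos not_le)
  have thick: "a\<^sup>2 * measure lebesgue (Y i) \<le> 64 * (Crad * \<delta>)\<^sup>2 * m i" if i: "i \<in> I" for i
  proof -
    have "a\<^sup>2 * measure lebesgue (Y i) \<le> 64 * (\<rho> i)\<^sup>2 * m i"
      unfolding m_def using Ym[OF i] YT[OF i] TB[OF i] PQ[OF i] \<rho>0[OF i] a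
      by (intro thickening_measure[OF B pos(1) _ _ PneQ[OF i]]) auto
    also have "\<dots> \<le> 64 * (Crad * \<delta>)\<^sup>2 * m i"
      using PQ[OF i] \<rho>0[OF i] by (intro mult_right_mono mult_left_mono power_mono) (auto simp: m_def)
    finally show ?thesis .
  qed
  define \<mu> where "\<mu> = shading_density I T Y"
  have Tsum: "n * (crad\<^sup>2 * \<delta>\<^sup>2 * (clen * r)) \<le> (\<Sum>i\<in>I. measure lebesgue (T i))"
    using sum_mono[of I "\<lambda>i. crad\<^sup>2 * \<delta>\<^sup>2 * (clen * r)" "\<lambda>i. measure lebesgue (T i)"] Tge by (simp add: n_def)
  have base: "0 < n * (crad\<^sup>2 * \<delta>\<^sup>2 * (clen * r))" using n0 cr a cl pos by simp
  have Tsum0: "0 < (\<Sum>i\<in>I. measure lebesgue (T i))" using Tsum base by linarith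
  show \<mu>0: "0 \<le> shading_density I T Y"
    unfolding shading_density_def by (intro divide_nonneg_nonneg sum_nonneg) auto
  have \<mu>1: "\<mu> \<le> 1"
  proof -
    have "(\<Sum>i\<in>I. measure lebesgue (Y i)) \<le> (\<Sum>i\<in>I. measure lebesgue (T i))"
      using YT Ym Tm by (intro sum_mono measure_mono_fmeasurable) auto
    then show ?thesis using Tsum0 by (simp add: \<mu>_def shading_density_def)
  qed
  have \<mu>m: "\<mu> * (n * a\<^sup>2 * r) \<le> G * (\<Sum>i\<in>I. m i)"
  proof -
    have "\<mu> * (\<Sum>i\<in>I. measure lebesgue (T i)) = (\<Sum>i\<in>I. measure lebesgue (Y i))"
      using Tsum0 by (simp add: \<mu>_def shading_density_def)
    moreover have "\<mu> * (n * (crad\<^sup>2 * \<delta>\<^sup>2 * (clen * r))) \<le> \<mu> * (\<Sum>i\<in>I. measure lebesgue (T i))"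
      using Tsum \<mu>0 by (intro mult_left_mono) (auto simp: \<mu>_def)
    ultimately have "a\<^sup>2 * (\<mu> * (n * (crad\<^sup>2 * \<delta>\<^sup>2 * (clen * r)))) \<le> a\<^sup>2 * (\<Sum>i\<in>I. measure lebesgue (Y i))"
      by (intro mult_left_mono) auto
    also have "\<dots> = (\<Sum>i\<in>I. a\<^sup>2 * measure lebesgue (Y i))" by (simp add: sum_distrib_left)
    also have "\<dots> \<le> (\<Sum>i\<in>I. 64 * (Crad * \<delta>)\<^sup>2 * m i)" by (intro sum_mono thick)
    also have "\<dots> = 64 * (Crad * \<delta>)\<^sup>2 * (\<Sum>i\<in>I. m i)" by (simp add: sum_distrib_left)
    finally have "(crad\<^sup>2 * clen * \<delta>\<^sup>2) * (\<mu> * (n * a\<^sup>2 * r)) \<le> (crad\<^sup>2 * clen * \<delta>\<^sup>2) * (G * (\<Sum>i\<in>I. m i))"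
      using cr cl by (simp add: G_def thickening_const_def power_mult_distrib mult_ac)
    then show ?thesis using cr cl a by simp
  qed
  have q1: "\<mu> powr (2 - \<sigma>) \<le> \<mu>"
  proof (cases "\<mu> = 0")
    case False
    then have "\<mu> powr (2 - \<sigma>) \<le> \<mu> powr 1" using \<mu>0 \<mu>1 \<sigma> unfolding \<mu>_def[symmetric] by (intro powr_mono') auto
    then show ?thesis using \<mu>0 unfolding \<mu>_def[symmetric] by simp
  qed simp
  have inc0: "0 < incidence_const \<sigma>" by (simp add: incidence_const_def add_pos_nonneg)
  define H where "H = G * (1 + Crad) * incidence_const \<sigma>"
  have H0: "0 < H" using G Cr inc0 by (simp add: H_def)
  have const: "projection_const crad Crad clen \<sigma> = 20736 * (1 + H) powr (2 - \<sigma>) + G * (1 + Crad)"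
    by (simp add: projection_const_def H_def G_def)
  have mW0: "0 \<le> measure lebesgue W" by simp
  have goal: "\<mu> powr (2 - \<sigma>) * measure lebesgue B \<le> projection_const crad Crad clen \<sigma> * C\<^sub>0 * measure lebesgue W"
  proof (cases "1 \<le> s")
    case True
    then have "b \<le> (1 + Crad) * a" using sb pos by (metis mult_1 mult_right_mono less_imp_le)
    have "m i \<le> measure lebesgue W" if "i \<in> I" for i
      unfolding m_def using subW[OF that] Wb box_inter_nbhd[OF B] by (intro measure_mono_fmeasurable) (auto simp: fmeasurableD)
    then have "(\<Sum>i\<in>I. m i) \<le> n * measure lebesgue W" using sum_mono[of I m "\<lambda>_. measure lebesgue W"] by (simp add: n_def)
    then have "\<mu> * (n * a\<^sup>2 * r) \<le> G * (n * measure lebesgue W)"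
      using \<mu>m G by (meson mult_left_mono less_imp_le order_trans)
    then have "n * (\<mu> * (a\<^sup>2 * r)) \<le> n * (G * measure lebesgue W)" by (simp add: mult_ac)
    then have 1: "\<mu> * (a\<^sup>2 * r) \<le> G * measure lebesgue W" using n0 by simp
    have "\<mu> powr (2 - \<sigma>) * measure lebesgue B \<le> \<mu> * (a * ((1 + Crad) * a) * r)"
      unfolding mB using q1 \<open>b \<le> (1 + Crad) * a\<close> pos \<mu>0 by (intro mult_mono) (auto simp: \<mu>_def)
    also have "\<dots> = (1 + Crad) * (\<mu> * (a\<^sup>2 * r))" by (simp add: power2_eq_square mult_ac)
    also have "\<dots> \<le> (1 + Crad) * (G * measure lebesgue W)" using 1 Cr by (intro mult_left_mono) auto
    also have "\<dots> \<le> projection_const crad Crad clen \<sigma> * measure lebesgue W"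
      unfolding const by (simp add: algebra_simps)
    also have "\<dots> \<le> projection_const crad Crad clen \<sigma> * measure lebesgue W * C\<^sub>0"
    proof -
      have "0 \<le> projection_const crad Crad clen \<sigma> * measure lebesgue W" using G Cr unfolding const by simp
      from mult_left_mono[OF C1 this] show ?thesis by simp
    qed
    finally show ?thesis by (simp add: mult_ac)
  next
    case False
    define W' where "W' = ?\<Phi> -` W \<inter> cbox 0 1"
    have \<Phi>cont: "continuous_on UNIV ?\<Phi>"
    proof -
      have "continuous_on UNIV (\<lambda>z. f (stretch3 a b r z))"
        using linear_compose[OF linear_stretch3 orthogonal_transformation_linear[OF f]]
        by (intro linear_continuous_on) (simp add: o_def linear_conv_bounded_linear)
      then show ?thesis unfolding chart_def[abs_def] by (intro continuous_intros)
    qed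
    have vm: "?\<Phi> -` A \<inter> cbox 0 1 \<in> sets borel" if "A \<in> sets borel" for A
      using measurable_sets[OF borel_measurable_continuous_onI[OF \<Phi>cont] that] by simp
    have vl: "?\<Phi> -` A \<inter> cbox 0 1 \<in> lmeasurable" if "A \<in> sets borel" for A
      by (rule lmeasurable_borel_bounded[OF vm[OF that]]) (auto intro: bounded_subset[OF bounded_cbox])
    have vmeas: "measure lebesgue A = a * b * r * measure lebesgue (?\<Phi> -` A \<inter> cbox 0 1)" if "A \<in> sets borel" "A \<subseteq> B" for A
    proof -
      have "?\<Phi> ` (?\<Phi> -` A \<inter> cbox 0 1) = A" using that(2) unfolding B1 by blast
      then show ?thesis using chart_measure(1)[OF f pos vl[OF that(1)], of c] by simp
    qed
    have mW: "measure lebesgue W = measure lebesgue B * measure lborel W'"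
      using vmeas[OF Wb(1)] vm[OF Wb(1)] unfolding mB W'_def by (simp add: W_def measure_completion)
    define \<Lambda> where "\<Lambda> = 20736 * C\<^sub>0"
    have \<Lambda>0: "0 < \<Lambda>" using C1 by (simp add: \<Lambda>_def)
    have F: "frostman_lines I p q \<phi> t s (\<Lambda> * card I) \<sigma>"
      unfolding frostman_lines_def
    proof (intro conjI allI ballI impI)
      fix \<psi> \<tau> w assume "s \<le> w"
      show "real (card {i \<in> I. \<bar>height \<psi> (p i) - \<tau>\<bar> \<le> w \<and> \<bar>height \<psi> (q i) - \<tau>\<bar> \<le> w}) \<le> \<Lambda> * card I * w powr (1 + \<sigma>)"
        unfolding \<Lambda>_def using C1 PQ TB \<rho>s pq
        by (intro concentration_imp_slab_count[OF f pos(1) a(3,4) B1 C _ I \<sigma> _ _ s0 \<open>s \<le> w\<close>]) auto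
    qed (use I pq norm_unit_cube in \<open>auto simp: t_def\<close>)
    have W'2: "W' \<subseteq> cball 0 2" using norm_unit_cube by (auto simp: W'_def)
    have q0: "0 < 2 - \<sigma>" using \<sigma> by simp
    show ?thesis
    proof (cases "\<Lambda> * measure lborel W' \<le> 1")
      case V: True
      define V where "V = \<Lambda> * measure lborel W'"
      have V0: "0 \<le> V" using \<Lambda>0 by (simp add: V_def)
      let ?S = "\<lambda>i. {x. -s \<le> height (\<phi> i) x - t i \<and> height (\<phi> i) x - t i < s}"
      have inc: "(\<Sum>i\<in>I. measure lborel (W' \<inter> ?S i)) \<le> incidence_const \<sigma> * n * s * V powr (1 / (2 - \<sigma>))"
        unfolding n_def V_def using incidence_mass[OF F s0 _ I(2) \<sigma> \<Lambda>0 _ W'2 V] False vm[OF Wb(1)] by (simp add: W'_def)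
      have mi: "m i \<le> a * b * r * measure lborel (W' \<inter> ?S i)" if i: "i \<in> I" for i
      proof -
        let ?A = "B \<inter> open_nbhd a (Y i)"
        have sub: "?\<Phi> -` ?A \<inter> cbox 0 1 \<subseteq> W' \<inter> ?S i"
        proof
          fix z assume z: "z \<in> ?\<Phi> -` ?A \<inter> cbox 0 1"
          then have "?\<Phi> z \<in> W" using subW[OF i] by blast
          moreover have "z \<in> ?S i"
          proof -
            obtain x where x: "x \<in> Y i" "dist (?\<Phi> z) x < a" using z in_open_nbhdD by blast
            then have "infdist x (closed_segment (P i) (Q i)) \<le> \<rho> i" using YT[OF i] PQ[OF i] by auto
            then obtain y where y: "y \<in> closed_segment (P i) (Q i)" "dist x y \<le> \<rho> i"
              using infdist_segment_attained by blast
            obtain v where v: "?\<Phi> v = y" and v': "\<forall>\<psi> \<tau> w. \<bar>height \<psi> (p i) - \<tau>\<bar> \<le> w \<longrightarrow> \<bar>height \<psi> (q i) - \<tau>\<bar> \<le> w \<longrightarrow> \<bar>height \<psi> v - \<tau>\<bar> \<le> w"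
              using height_on_segment[OF f _ _ y(1), of c a b r "p i" "q i"] pq[OF i] by blast
            have "\<bar>height (\<phi> i) v - t i\<bar> \<le> 0" using v'[rule_format, of "\<phi> i" "t i" 0] pq[OF i] by (simp add: t_def)
            then have hv: "height (\<phi> i) v = t i" by simp
            have "\<bar>height (\<phi> i) z - height (\<phi> i) v\<bar> * b \<le> dist (?\<Phi> z) (?\<Phi> v)"
              using pos a by (intro height_chart_lipschitz[OF f]) auto
            also have "\<dots> \<le> dist (?\<Phi> z) x + dist x y" unfolding v by (rule dist_triangle)
            also have "\<dots> < s * b" unfolding sb using x y \<rho>a[OF i] by (simp add: algebra_simps)
            finally have "\<bar>height (\<phi> i) z - t i\<bar> < s" using pos hv by simp
            then show ?thesis by auto
          qed
          ultimately show "z \<in> W' \<inter> ?S i" using z by (simp add: W'_def)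
        qed
        have Sb: "W' \<inter> ?S i \<in> sets borel"
        proof -
          have "?S i \<in> sets borel" by measurable
          then show ?thesis using vm[OF Wb(1)] by (auto simp: W'_def)
        qed
        have Sl: "W' \<inter> ?S i \<in> lmeasurable"
          by (rule lmeasurable_borel_bounded[OF Sb]) (auto simp: W'_def intro: bounded_subset[OF bounded_cbox])
        have "measure lebesgue (?\<Phi> -` ?A \<inter> cbox 0 1) \<le> measure lebesgue (W' \<inter> ?S i)"
          by (rule measure_mono_fmeasurable[OF sub fmeasurableD[OF vl[OF box_inter_nbhd(1)[OF B]]] Sl])
        also have "\<dots> = measure lborel (W' \<inter> ?S i)" using Sb by (simp add: measure_completion)
        finally show ?thesis
          unfolding m_def vmeas[OF box_inter_nbhd(1)[OF B] Int_lower1] using pos by (intro mult_left_mono) auto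
      qed
      have "(\<Sum>i\<in>I. m i) \<le> a * b * r * (\<Sum>i\<in>I. measure lborel (W' \<inter> ?S i))"
        unfolding sum_distrib_left by (intro sum_mono mi)
      also have "\<dots> \<le> a * b * r * (incidence_const \<sigma> * n * s * V powr (1 / (2 - \<sigma>)))"
        using inc pos by (intro mult_left_mono) auto
      also have "\<dots> = a * (s * b) * r * (incidence_const \<sigma> * n * V powr (1 / (2 - \<sigma>)))" by (simp add: mult_ac)
      finally have "G * (\<Sum>i\<in>I. m i) \<le> G * (a * (s * b) * r * (incidence_const \<sigma> * n * V powr (1 / (2 - \<sigma>))))"
        using G by (intro mult_left_mono) auto
      then have "\<mu> * (n * a\<^sup>2 * r) \<le> G * (a * (s * b) * r * (incidence_const \<sigma> * n * V powr (1 / (2 - \<sigma>))))"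
        using \<mu>m by linarith
      also have "\<dots> = (H * V powr (1 / (2 - \<sigma>))) * (n * a\<^sup>2 * r)"
        unfolding sb H_def by (simp add: power2_eq_square mult_ac)
      finally have "\<mu> \<le> H * V powr (1 / (2 - \<sigma>))" using n0 pos by simp
      also have "\<dots> \<le> (1 + H) * V powr (1 / (2 - \<sigma>))" by (intro mult_right_mono) auto
      finally have "\<mu> powr (2 - \<sigma>) \<le> ((1 + H) * V powr (1 / (2 - \<sigma>))) powr (2 - \<sigma>)"
        using \<mu>0 q0 unfolding \<mu>_def[symmetric] by (intro powr_mono2) auto
      also have "\<dots> = (1 + H) powr (2 - \<sigma>) * V"
        using H0 V0 q0 by (simp add: powr_mult powr_powr)
      finally have "\<mu> powr (2 - \<sigma>) * measure lebesgue B \<le> (1 + H) powr (2 - \<sigma>) * V * measure lebesgue B"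
        by (intro mult_right_mono) auto
      also have "\<dots> = 20736 * (1 + H) powr (2 - \<sigma>) * C\<^sub>0 * measure lebesgue W"
        unfolding mW V_def \<Lambda>_def by (simp add: mult_ac)
      also have "\<dots> \<le> projection_const crad Crad clen \<sigma> * C\<^sub>0 * measure lebesgue W"
        unfolding const using G Cr C1 by (intro mult_right_mono) auto
      finally show ?thesis .
    next
      case False
      have "\<mu> powr (2 - \<sigma>) * measure lebesgue B \<le> 1 * measure lebesgue B"
        using q1 \<mu>1 by (intro mult_right_mono) auto
      also have "\<dots> \<le> \<Lambda> * measure lborel W' * measure lebesgue B"
        using False by (intro mult_right_mono) auto
      also have "\<dots> = 20736 * 1 * C\<^sub>0 * measure lebesgue W" unfolding mW \<Lambda>_def by (simp add: mult_ac)
      also have "\<dots> \<le> projection_const crad Crad clen \<sigma> * C\<^sub>0 * measure lebesgue W"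
      proof -
        have "1 \<le> (1 + H) powr (2 - \<sigma>)" using H0 q0 by (intro ge_one_powr_ge_zero) auto
        then show ?thesis unfolding const using G Cr C1 by (intro mult_right_mono add_increasing2) auto
      qed
      finally show ?thesis .
    qed
  qed
  show "shading_density I T Y powr (2 - \<sigma>) * measure lebesgue B
      \<le> projection_const crad Crad clen \<sigma> * C\<^sub>0 * measure lebesgue (B \<inter> open_nbhd a (\<Union>i\<in>I. Y i))"
    using goal by (simp add: W_def \<mu>_def)
qed

text \<open>Both estimates of the theorem weaken \<open>projection_bound\<close>: as \<open>C \<ge> 1\<close>, the factor \<open>1 / C\<close> dominates \<open>C powr (- q)\<close>, and
  a further factor \<open>x \<le> 1\<close> is harmless.\<close>

lemma insert_factor_into_bound:
  assumes "0 < K" "1 \<le> C" "1 \<le> q" "0 \<le> x" "x \<le> 1" "L * m \<le> K * C * w" "0 \<le> L" "0 \<le> m"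
  shows "1 / K * C powr (- q) * x * L * m \<le> (w::real)"
proof -
  have "C powr (- q) \<le> C powr (- 1)" using assms by (intro powr_mono) auto
  then have "C powr (- q) \<le> 1 / C" using assms by (simp add: powr_minus_divide)
  then have "C powr (- q) * x \<le> 1 / C * 1" using assms by (intro mult_mono) auto
  then have "1 / K * (C powr (- q) * x) * (L * m) \<le> 1 / K * (1 / C) * (K * C * w)"
    using assms by (intro mult_mono[OF mult_left_mono assms(6)]) auto
  also have "\<dots> = w" using assms by simp
  finally show ?thesis by (simp add: mult.assoc)
qed

theorem theorem6p1:
  fixes crad Crad clen Clen \<sigma> q :: real
  assumes "0 < crad" "crad \<le> Crad" "0 < clen" "clen \<le> Clen"
    and "0 < \<sigma>" "\<sigma> \<le> 1"
    and "q = 2 - \<sigma>"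
  shows
    "(\<forall>\<epsilon>::real. \<epsilon> > 0 \<longrightarrow> (\<exists>c>0. \<forall>\<delta> a b r C\<^sub>0 B I T Y.
        0 < \<delta> \<and> \<delta> \<le> a \<and> a \<le> b \<and> b \<le> r \<and> rect_box a b r B \<and>
        shaded_tubes_in_box crad Crad clen Clen \<delta> r B I T Y \<and>
        convex_concentration_bound C\<^sub>0 \<sigma> B I T \<longrightarrow>
          measure lebesgue (B \<inter> open_nbhd a (\<Union>i\<in>I. Y i))
            \<ge> c * C\<^sub>0 powr (- q) * (a / b) powr \<epsilon>
                * shading_density I T Y powr q * measure lebesgue B))
     \<and>
     (\<forall>\<eta>::real. \<eta> > 0 \<longrightarrow> (\<exists>c>0. \<forall>\<delta> a b r C\<^sub>0 B I T Y.
        0 < \<delta> \<and> \<delta> \<le> a \<and> a \<le> b \<and> b \<le> r \<and> rect_box a b r B \<and>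
        shaded_tubes_in_box crad Crad clen Clen \<delta> r B I T Y \<and>
        convex_concentration_bound C\<^sub>0 \<sigma> B I T \<longrightarrow>
          measure lebesgue (B \<inter> open_nbhd a (\<Union>i\<in>I. Y i))
            \<ge> c * C\<^sub>0 powr (- q) * ln (2 / (a / b)) powr (- q) * (a / b) powr (q * \<eta>)
                * shading_density I T Y powr q * measure lebesgue B))"
proof -
  define K where "K = projection_const crad Crad clen \<sigma>"
  have inc0: "0 < incidence_const \<sigma>" by (simp add: incidence_const_def add_pos_nonneg)
  have G0: "0 < thickening_const crad Crad clen * (1 + Crad)"
    using assms by (simp add: thickening_const_def)
  have K0: "0 < K"
    using G0 unfolding K_def projection_const_def by (intro add_nonneg_pos) auto
  have q1: "1 \<le> q" using assms by simp
  have core: "1 / K * C\<^sub>0 powr (- q) * x * shading_density I T Y powr q * measure lebesgue B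
       \<le> measure lebesgue (B \<inter> open_nbhd a (\<Union>i\<in>I. Y i))"
    if x: "0 \<le> x" "x \<le> 1"
      and h: "0 < \<delta> \<and> \<delta> \<le> a \<and> a \<le> b \<and> b \<le> r \<and> rect_box a b r B \<and>
        shaded_tubes_in_box crad Crad clen Clen \<delta> r B I T Y \<and> convex_concentration_bound C\<^sub>0 \<sigma> B I T"
    for x \<delta> a b r C\<^sub>0 B I T Y
  proof -
    note pb = projection_bound[OF assms(1-3,5,6), of \<delta> a b r B Clen I T Y C\<^sub>0]
    show ?thesis
      using pb h x K0 q1 unfolding assms(7) K_def[symmetric]
      by (intro insert_factor_into_bound) auto
  qed
  have ab: "0 < a / b" "a / b \<le> 1" if "0 < \<delta> \<and> \<delta> \<le> a \<and> a \<le> b" for a b \<delta> :: real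
    using that by (auto simp: divide_le_eq_1)
  show ?thesis
  proof (intro conjI allI impI)
    fix \<epsilon> :: real assume "0 < \<epsilon>"
    show "\<exists>c>0. \<forall>\<delta> a b r C\<^sub>0 B I T Y.
        0 < \<delta> \<and> \<delta> \<le> a \<and> a \<le> b \<and> b \<le> r \<and> rect_box a b r B \<and>
        shaded_tubes_in_box crad Crad clen Clen \<delta> r B I T Y \<and>
        convex_concentration_bound C\<^sub>0 \<sigma> B I T \<longrightarrow>
          measure lebesgue (B \<inter> open_nbhd a (\<Union>i\<in>I. Y i))
            \<ge> c * C\<^sub>0 powr (- q) * (a / b) powr \<epsilon>
                * shading_density I T Y powr q * measure lebesgue B"
    proof (intro exI[of _ "1 / K"] conjI allI impI)
      fix \<delta> a b r C\<^sub>0 B I T Y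
      assume h: "0 < \<delta> \<and> \<delta> \<le> a \<and> a \<le> b \<and> b \<le> r \<and> rect_box a b r B \<and>
        shaded_tubes_in_box crad Crad clen Clen \<delta> r B I T Y \<and> convex_concentration_bound C\<^sub>0 \<sigma> B I T"
      have "(a / b) powr \<epsilon> \<le> 1" using ab[of \<delta> a b] h \<open>0 < \<epsilon>\<close> by (intro powr_le1) auto
      then show "measure lebesgue (B \<inter> open_nbhd a (\<Union>i\<in>I. Y i))
            \<ge> 1 / K * C\<^sub>0 powr (- q) * (a / b) powr \<epsilon> * shading_density I T Y powr q * measure lebesgue B"
        using core[OF _ _ h] by simp
    qed (use K0 in simp)
  next
    fix \<eta> :: real assume "0 < \<eta>"
    show "\<exists>c>0. \<forall>\<delta> a b r C\<^sub>0 B I T Y.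
        0 < \<delta> \<and> \<delta> \<le> a \<and> a \<le> b \<and> b \<le> r \<and> rect_box a b r B \<and>
        shaded_tubes_in_box crad Crad clen Clen \<delta> r B I T Y \<and>
        convex_concentration_bound C\<^sub>0 \<sigma> B I T \<longrightarrow>
          measure lebesgue (B \<inter> open_nbhd a (\<Union>i\<in>I. Y i))
            \<ge> c * C\<^sub>0 powr (- q) * ln (2 / (a / b)) powr (- q) * (a / b) powr (q * \<eta>)
                * shading_density I T Y powr q * measure lebesgue B"
    proof (intro exI[of _ "ln 2 powr q / K"] conjI allI impI)
      fix \<delta> a b r C\<^sub>0 B I T Y
      assume h: "0 < \<delta> \<and> \<delta> \<le> a \<and> a \<le> b \<and> b \<le> r \<and> rect_box a b r B \<and>
        shaded_tubes_in_box crad Crad clen Clen \<delta> r B I T Y \<and> convex_concentration_bound C\<^sub>0 \<sigma> B I T"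
      define x where "x = ln 2 powr q * (ln (2 / (a / b)) powr (- q) * (a / b) powr (q * \<eta>))"
      have s: "0 < a / b" "a / b \<le> 1" using ab[of \<delta> a b] h by auto
      have "2 * 1 \<le> 2 / (a / b)" using s by (intro mult_imp_le_div_pos) auto
      then have "ln 2 \<le> ln (2 / (a / b))" using s by (intro ln_mono) auto
      then have "ln (2 / (a / b)) powr (- q) \<le> ln 2 powr (- q)" using q1 by (intro powr_mono2') auto
      moreover have "(a / b) powr (q * \<eta>) \<le> 1" using s q1 \<open>0 < \<eta>\<close> by (intro powr_le1) auto
      ultimately have "ln (2 / (a / b)) powr (- q) * (a / b) powr (q * \<eta>) \<le> ln 2 powr (- q) * 1"
        by (intro mult_mono) auto
      then have "x \<le> ln 2 powr q * (ln 2 powr (- q) * 1)" unfolding x_def by (intro mult_left_mono) auto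
      also have "\<dots> = 1" by (simp flip: powr_add)
      finally have "x \<le> 1" .
      moreover have "0 \<le> x" by (simp add: x_def)
      ultimately show "measure lebesgue (B \<inter> open_nbhd a (\<Union>i\<in>I. Y i))
            \<ge> ln 2 powr q / K * C\<^sub>0 powr (- q) * ln (2 / (a / b)) powr (- q) * (a / b) powr (q * \<eta>)
               * shading_density I T Y powr q * measure lebesgue B"
        using core[OF _ _ h, of x] by (simp add: x_def mult_ac)
    qed (use K0 in simp)
  qed
qed

end
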